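(* Let $d \ge 1$, $r \ge 2$, $t \ge 2$ be integers and let $\vec{F} = (F_1,\dots,F_r)$ be an $r$-direction-vector in $\mathbb{R}^d$. Then, as $n \to \infty$, \[ z_d^{\vec{F}}(n; t) = \begin{cases} \Theta_r (t n^{r-1}) & \text{if } \vec{F} \text{ is non-}2\text{-coherent}, \\ \Omega \bigl( t n^{r-1} \frac{\log n}{\log\log n} \bigr) & \text{if } \vec{F} \text{ is } 2\text{-coherent}. \end{cases} \]
   Context: An (axis-parallel) box in $\mathbb{R}^d$ is a set $[a_1,b_1]\times\cdots\times[a_d,b_d]$ with real $a_i \le b_i$ (degenerate intervals $a_i=b_i$ allowed). Its direction set is $\{i \in \{1,\dots,d\} : a_i < b_i\}$. An $r$-direction-vector in $\mathbb{R}^d$ is an $r$-tuple $\vec{F}=(F_1,\dots,F_r)$ of subsets of $\{1,\dots,d\}$. An $r$-tuple $(\mathcal{B}_1,\dots,\mathcal{B}_r)$ of multisets of boxes is an $\vec{F}$-family if every box in $\mathcal{B}_j$ has direction set exactly $F_j$. Its intersection hypergraph $\mathcal{H}$ is the $r$-partite $r$-uniform hypergraph with vertex set the (multiset) elements of $\mathcal{B}_1\cup\dots\cup\mathcal{B}_r$, where $\{\mathbf{b}_1,\dots,\mathbf{b}_r\}$ with $\mathbf{b}_j\in\mathcal{B}_j$ is a hyperedge iff $\mathbf{b}_1\cap\dots\cap\mathbf{b}_r\neq\varnothing$. $\mathcal{H}$ contains $K^{(r)}_{t,\dots,t}$ if there are subsets $S_j\subseteq\mathcal{B}_j$ of $t$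 distinct elements each such that every choice of one element from each $S_j$ is a hyperedge. For positive integers $n_1,\dots,n_r$, $z_d^{\vec{F}}(n_1,\dots,n_r;t)$ denotes the maximum number of hyperedges of the intersection hypergraph of an $\vec{F}$-family with $|\mathcal{B}_j|=n_j$ for all $j$ that contains no $K^{(r)}_{t,\dots,t}$; $z_d^{\vec{F}}(n;t)$ abbreviates $z_d^{\vec{F}}(n,\dots,n;t)$. The vector $\vec{F}$ is $2$-coherent if there exists $k\in\{1,\dots,r\}$ with $\bigl|\bigcap_{j\neq k} F_j\bigr|\ge 2$, and non-$2$-coherent otherwise. $\Theta_r$ means bounded above and below by positive constant multiples where the constants depend only on $r$. *)

theory Defs
  imports Complex_Main "HOL-Library.FuncSet" "HOL-Library.Multiset"
begin

text \<open>
  The dimension \<open>d\<close> is a natural number and not a type, so that constants can be chosen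
  independently of \<open>d\<close>: a point of \<open>d\<close>-dimensional space is an extensional function on
  \<open>{1..d}\<close>, and a box is a set of such points.
\<close>

definition axis_box :: "nat \<Rightarrow> (nat \<Rightarrow> real) \<Rightarrow> (nat \<Rightarrow> real) \<Rightarrow> (nat \<Rightarrow> real) set"
  where "axis_box d a b = (\<Pi>\<^sub>E i\<in>{1..d}. {a i..b i})"

text \<open>
  The endpoints of a box, being those of a product of nonempty intervals, are determined by the
  box on \<open>{1..d}\<close>; hence so is its direction set.
\<close>

definition boxes_with_directions :: "nat \<Rightarrow> nat set \<Rightarrow> (nat \<Rightarrow> real) set set"
  where "boxes_with_directions d D =
    {axis_box d a b | a b. (\<forall>i\<in>{1..d}. a i \<le> b i) \<and> {i\<in>{1..d}. a i < b i} = D}"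

definition direction_vector :: "nat \<Rightarrow> nat \<Rightarrow> (nat \<Rightarrow> nat set) \<Rightarrow> bool"
  where "direction_vector d r F \<longleftrightarrow> (\<forall>j\<in>{1..r}. F j \<subseteq> {1..d})"

definition two_coherent :: "nat \<Rightarrow> (nat \<Rightarrow> nat set) \<Rightarrow> bool"
  where "two_coherent r F \<longleftrightarrow> (\<exists>k\<in>{1..r}. card (\<Inter>j\<in>{1..r} - {k}. F j) \<ge> 2)"

definition box_family ::
    "nat \<Rightarrow> nat \<Rightarrow> (nat \<Rightarrow> nat set) \<Rightarrow> (nat \<Rightarrow> (nat \<Rightarrow> real) set multiset) \<Rightarrow> bool"
  where "box_family d r F B \<longleftrightarrow> (\<forall>j\<in>{1..r}. set_mset (B j) \<subseteq> boxes_with_directions d (F j))"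

text \<open>
  The vertex \<open>(j, b, c)\<close> is the \<open>c\<close>-th copy of the box \<open>b\<close> in the multiset \<open>B j\<close>. The tag \<open>j\<close>
  keeps the parts disjoint when the same box occurs in several of the multisets.
\<close>

type_synonym box_vertex = "nat \<times> (nat \<Rightarrow> real) set \<times> nat"

definition part :: "(nat \<Rightarrow> (nat \<Rightarrow> real) set multiset) \<Rightarrow> nat \<Rightarrow> box_vertex set"
  where "part B j = {(j, b, c) | b c. c < count (B j) b}"

definition box_of :: "box_vertex \<Rightarrow> (nat \<Rightarrow> real) set"
  where "box_of v = fst (snd v)"

definition hyperedges :: "nat \<Rightarrow> (nat \<Rightarrow> (nat \<Rightarrow> real) set multiset) \<Rightarrow> box_vertex set set"
  where "hyperedges r B =
    {v ` {1..r} | v. (\<forall>j\<in>{1..r}. v j \<in> part B j) \<and> (\<Inter>j\<in>{1..r}. box_of (v j)) \<noteq> {}}"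

definition contains_complete ::
    "nat \<Rightarrow> nat \<Rightarrow> (nat \<Rightarrow> (nat \<Rightarrow> real) set multiset) \<Rightarrow> bool"
  where "contains_complete r t B \<longleftrightarrow>
    (\<exists>S. (\<forall>j\<in>{1..r}. S j \<subseteq> part B j \<and> card (S j) = t) \<and>
         (\<forall>v. (\<forall>j\<in>{1..r}. v j \<in> S j) \<longrightarrow> v ` {1..r} \<in> hyperedges r B))"

text \<open>
  For \<open>d \<ge> 1\<close>, \<open>r \<ge> 2\<close> and \<open>t \<ge> 1\<close> the maximum is over a nonempty set (some family has no
  hyperedge at all) that is bounded by the product of the \<open>n j\<close>.
\<close>

definition zarankiewicz ::
    "nat \<Rightarrow> nat \<Rightarrow> (nat \<Rightarrow> nat set) \<Rightarrow> (nat \<Rightarrow> nat) \<Rightarrow> nat \<Rightarrow> nat"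
  where "zarankiewicz d r F n t =
    Max {card (hyperedges r B) | B.
      box_family d r F B \<and> (\<forall>j\<in>{1..r}. size (B j) = n j) \<and> \<not> contains_complete r t B}"

end

theory Submission
  imports Defs "HOL-Real_Asymp.Real_Asymp" "HOL-Library.Product_Lexorder"
begin

text \<open>
  Upper bound: after fixing the coordinates in all directions where two parts are degenerate,
  non-2-coherence leaves either a single direction, or directions that are each degenerate in
  exactly one part, a different one each. In the first case every hyperedge has a box with the
  largest left endpoint, which may be shrunk to that endpoint, so the second case is the general one.
  There a hyperedge is a point of a grid of axis-parallel lines, and a hyperedge that is not among
  the topmost ones of its lines spans a brick in which, since there is no complete subhypergraph, at
  least \<open>t\<close> boxes must end; charging hyperedges to these ends gives the bound.

  Lower bounds: \<open>t - 1\<close> boxes of one part that meet all boxes of the other parts give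
  \<open>(t - 1) * n ^ (r - 1)\<close> hyperedges. In the 2-coherent case, the points and combinatorial lines of
  \<open>[b] ^ b\<close> embed into the plane as points and rectangles; each point lies on \<open>b\<close> lines, and two
  lines share at most one point. Take \<open>t - 1\<close> copies of each, with
  \<open>b\<close> of order \<open>ln n / ln (ln n)\<close>, and make the boxes of all other parts contain everything.
\<close>

section \<open>Systems of boxes with one degenerate direction each\<close>

text \<open>Call a direction unpinned if at most one part is degenerate in it. If two unpinned
  directions are both nondegenerate in all parts except possibly the same part \<open>k\<close>,
  they both lie in every \<open>F j\<close> with \<open>j \<noteq> k\<close>, which is 2-coherence.
  So each part owns at most one unpinned direction, and a direction nondegenerate in all parts
  excludes every other unpinned one.

  The bound is linear in \<open>t\<close> although recovering an edge from a charge costs two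
  factors of order \<open>t\<close>: each surviving edge is charged at least \<open>t\<close> times,
  which cancels one of them.

  Length and base of the digit vectors agree for the sake of balance. Vectors of length
  \<open>m\<close> in base \<open>b\<close> give \<open>b ^ m\<close> points,
  \<open>m * b ^ (m - 1)\<close> lines and \<open>m\<close> lines through each point, so
  \<open>m = b\<close> yields as many lines as points, and \<open>b ^ b \<le> n\<close> allows a
  degree \<open>b\<close> of the required order. The \<open>t - 1\<close> copies are harmless, since
  \<open>t\<close> boxes of one part include two with different underlying points or lines.\<close>

lemma inj_on_card_above:
  fixes p :: "'v \<Rightarrow> 'a::linorder"
  assumes "finite X" "inj_on p X"
  shows "inj_on (\<lambda>x. card {y\<in>X. p x < p y}) X"
proof -
  have less: "card {y\<in>X. p x' < p y} < card {y\<in>X. p x < p y}"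
    if "x \<in> X" "x' \<in> X" "p x < p x'" for x x'
    using assms(1) that by (intro psubset_card_mono) auto
  show ?thesis
  proof (rule inj_onI)
    fix x y assume "x \<in> X" "y \<in> X" "card {z\<in>X. p x < p z} = card {z\<in>X. p y < p z}"
    then have "p x = p y"
      using less[of x y] less[of y x] by (metis less_irrefl_nat neqE)
    then show "x = y" using assms(2) \<open>x \<in> X\<close> \<open>y \<in> X\<close> by (auto dest: inj_onD)
  qed
qed

lemma card_few_above:
  fixes p :: "'v \<Rightarrow> 'a::linorder"
  assumes "finite X" "inj_on p X"
  shows "card {x\<in>X. card {y\<in>X. p x < p y} < s} \<le> s"
proof -
  have "card {x\<in>X. card {y\<in>X. p x < p y} < s} \<le> card {..<s}"
  proof (rule card_inj_on_le[where f = "\<lambda>x. card {y\<in>X. p x < p y}"])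
    show "inj_on (\<lambda>x. card {y\<in>X. p x < p y}) {x\<in>X. card {y\<in>X. p x < p y} < s}"
      by (rule inj_on_subset[OF inj_on_card_above[OF assms]]) simp
  qed auto
  then show ?thesis by simp
qed

text \<open>Ranks from the top are injective and below \<open>card X\<close>, so they take every
  value below \<open>card X\<close>; \<open>y\<close> is the element of rank
  \<open>card X - s\<close>.\<close>

lemma initial_segment_of_card:
  fixes p :: "'v \<Rightarrow> 'a::linorder"
  assumes "finite X" "inj_on p X" "0 < s" "s \<le> card X"
  shows "\<exists>y\<in>X. card {x\<in>X. p x \<le> p y} = s"
proof -
  let ?f = "\<lambda>x. card {y\<in>X. p x < p y}"
  have "?f x < card X" if "x \<in> X" for x
    using assms(1) that by (intro psubset_card_mono) auto
  then have "?f ` X \<subseteq> {..<card X}" by auto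
  moreover have "card (?f ` X) = card X"
    by (rule card_image[OF inj_on_card_above[OF assms(1,2)]])
  ultimately have "?f ` X = {..<card X}"
    by (intro card_subset_eq) auto
  moreover have "card X - s \<in> {..<card X}" using assms(3,4) by auto
  ultimately have "card X - s \<in> ?f ` X" by simp
  then obtain y where y: "y \<in> X" "?f y = card X - s" by (metis (no_types, lifting) imageE)
  have "card X = card ({x\<in>X. p x \<le> p y} \<union> {x\<in>X. p y < p x})"
    by (rule arg_cong[where f = card]) auto
  also have "\<dots> = card {x\<in>X. p x \<le> p y} + ?f y"
    using assms(1) by (intro card_Un_disjoint) auto
  finally have "card {x\<in>X. p x \<le> p y} = s" using y(2) assms(4) by simp
  then show ?thesis using y(1) by (rule bexI)
qed

text \<open>The counting scheme of all recovery steps: an element of \<open>A\<close> is decoded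
  from some \<open>w\<close> together with one of at most \<open>s\<close> candidates that depend on
  \<open>w\<close> only.\<close>

lemma card_image_Sigma_le:
  assumes "finite W" "\<And>w. w \<in> W \<Longrightarrow> finite (T w)" "\<And>w. w \<in> W \<Longrightarrow> card (T w) \<le> s"
    "A \<subseteq> f ` Sigma W T"
  shows "card A \<le> s * card W"
proof -
  have "finite (Sigma W T)" using assms(1,2) by auto
  then have "card A \<le> card (Sigma W T)" using assms(4) by (rule surj_card_le)
  also have "\<dots> = (\<Sum>w\<in>W. card (T w))" using assms(1,2) by simp
  also have "\<dots> \<le> card W * s" using sum_bounded_above[OF assms(3)] by simp
  finally show ?thesis by (simp add: mult.commute)
qed

text \<open>
  A vertex \<open>v\<close> of part \<open>j\<close> models a box that is degenerate in direction \<open>j\<close>, where it sits at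
  \<open>p j v\<close>, and equals \<open>[L j k v, U j k v]\<close> in direction \<open>k \<noteq> j\<close>. Positions are injective on each
  part, so that ranks along a line make sense.
\<close>

locale box_system =
  fixes R :: "'i set" and V :: "'i \<Rightarrow> 'v set" and p :: "'i \<Rightarrow> 'v \<Rightarrow> 'a::linorder"
    and L U :: "'i \<Rightarrow> 'i \<Rightarrow> 'v \<Rightarrow> 'a"
  assumes finite_R: "finite R"
    and finite_V: "\<And>j. j \<in> R \<Longrightarrow> finite (V j)"
    and inj_p: "\<And>j. j \<in> R \<Longrightarrow> inj_on (p j) (V j)"
begin

definition spans :: "'i \<Rightarrow> 'i \<Rightarrow> 'v \<Rightarrow> 'a \<Rightarrow> bool"
  where "spans j k v x \<longleftrightarrow> L j k v \<le> x \<and> x \<le> U j k v"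

text \<open>Box \<open>k\<close> is a point in direction \<open>k\<close>, so
  \<open>p k (e k)\<close> is the only candidate for that coordinate of a common point, and the
  other boxes need to be tested only there.\<close>

definition edges :: "('i \<Rightarrow> 'v) set"
  where "edges = {e \<in> PiE R V. \<forall>j\<in>R. \<forall>k\<in>R. j \<noteq> k \<longrightarrow> spans j k (e j) (p k (e k))}"

definition above :: "('i \<Rightarrow> 'v) set \<Rightarrow> 'i \<Rightarrow> ('i \<Rightarrow> 'v) \<Rightarrow> 'v set"
  where "above A j e = {b \<in> V j. e(j := b) \<in> A \<and> p j (e j) < p j b}"

lemma spans_between: "spans j k v x \<Longrightarrow> spans j k v y \<Longrightarrow> x \<le> z \<Longrightarrow> z \<le> y \<Longrightarrow> spans j k v z"
  by (auto simp: spans_def)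

lemma edgesD:
  assumes "e \<in> edges"
  shows "e \<in> PiE R V" "\<And>j k. j \<in> R \<Longrightarrow> k \<in> R \<Longrightarrow> j \<noteq> k \<Longrightarrow> spans j k (e j) (p k (e k))"
  using assms by (auto simp: edges_def)

lemma edges_subset: "edges \<subseteq> PiE R V" by (auto simp: edges_def)

lemma finite_PiE_V: "K \<subseteq> R \<Longrightarrow> finite (PiE K V)"
  using finite_R finite_V by (intro finite_PiE) (auto intro: finite_subset)

lemma finite_edges: "finite edges"
  using edges_subset finite_PiE_V[of R] finite_subset by auto

lemma inj_p_subset: "j \<in> R \<Longrightarrow> X \<subseteq> V j \<Longrightarrow> inj_on (p j) X"
  using inj_p inj_on_subset by blast

text \<open>A line in direction \<open>j\<close> is a choice of all components but \<open>j\<close>.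
  Ranks from the top are distinct on it, so at most \<open>s\<close> of its edges have rank below
  \<open>s\<close>; the product counts the lines.\<close>

lemma card_few_above_edges:
  assumes A: "A \<subseteq> PiE R V" and j: "j \<in> R"
  shows "card {e\<in>A. card (above A j e) < s} \<le> s * (\<Prod>m\<in>R-{j}. card (V m))"
proof -
  define X where "X w = {b \<in> V j. w(j := b) \<in> A}" for w
  define T where "T w = {x \<in> X w. card {y\<in>X w. p j x < p j y} < s}" for w
  have fX: "finite (X w)" for w using finite_V[OF j] by (auto simp: X_def)
  have "card {e\<in>A. card (above A j e) < s} \<le> s * card (PiE (R-{j}) V)"
  proof (rule card_image_Sigma_le[where T = T and f = "\<lambda>(w, x). w(j := x)"])
    show "finite (PiE (R-{j}) V)" by (rule finite_PiE_V) auto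
    show "finite (T w)" for w using fX[of w] by (auto simp: T_def)
    have "inj_on (p j) (X w)" for w by (rule inj_p_subset[OF j]) (auto simp: X_def)
    then show "card (T w) \<le> s" for w unfolding T_def by (rule card_few_above[OF fX])
    show "{e\<in>A. card (above A j e) < s} \<subseteq> (\<lambda>(w, x). w(j := x)) ` Sigma (PiE (R-{j}) V) T"
    proof
      fix e assume "e \<in> {e\<in>A. card (above A j e) < s}"
      then have e: "e \<in> A" "card (above A j e) < s" by auto
      then have eP: "e \<in> PiE R V" using A by auto
      define w where "w = restrict e (R-{j})"
      have w: "w(j := b) = e(j := b)" for b
        using PiE_arb[OF eP] by (auto simp: w_def fun_eq_iff)
      have "above A j e = {y\<in>X w. p j (e j) < p j y}" by (auto simp: above_def X_def w)
      moreover have "e j \<in> X w" using e eP j by (auto simp: X_def w)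
      ultimately have "e j \<in> T w" using e by (simp add: T_def)
      moreover have "w \<in> PiE (R-{j}) V" using eP by (auto simp: w_def)
      ultimately show "e \<in> (\<lambda>(w, x). w(j := x)) ` Sigma (PiE (R-{j}) V) T"
        by (intro image_eqI[of _ _ "(w, e j)"]) (auto simp: w)
    qed
  qed
  then show ?thesis using finite_R by (simp add: card_PiE)
qed

end

section \<open>The charging argument for systems without a complete subhypergraph\<close>

locale complete_free_box_system = box_system R V p L U
  for R :: "'i set" and V :: "'i \<Rightarrow> 'v set" and p :: "'i \<Rightarrow> 'v \<Rightarrow> 'a::linorder"
    and L U :: "'i \<Rightarrow> 'i \<Rightarrow> 'v \<Rightarrow> 'a" +
  fixes t :: nat and a :: 'i
  assumes a_in: "a \<in> R" and t_pos: "0 < t"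
    and complete_free: "\<And>S. (\<And>j. j \<in> R \<Longrightarrow> S j \<subseteq> V j \<and> card (S j) = t) \<Longrightarrow> \<not> PiE R S \<subseteq> edges"
begin

text \<open>
  Discarding the topmost edges of every line costs \<open>O(t)\<close> edges per line. Around an edge \<open>e\<close> that
  survives there is a brick with corner \<open>e\<close>: in direction \<open>a\<close> it contains the next \<open>t\<close> edges, and in
  every other direction \<open>j\<close> its height is chosen such that exactly \<open>2 * t\<close> vertices of part \<open>j\<close> meet
  its \<open>j\<close>-axis. If in every part at least \<open>t\<close> of these span the brick, they form a complete
  subhypergraph. Otherwise some part \<open>j\<close> has \<open>t\<close> vertices \<open>b\<close> with an endpoint (in some direction
  \<open>k\<close>) inside the brick, and \<open>e\<close> is charged to the tuple that arises from \<open>e\<close> by replacing \<open>e j\<close>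
  with \<open>b\<close> and forgetting \<open>e k\<close>. From such a tuple \<open>e j\<close> is recovered up to \<open>O(t)\<close> choices, being
  among the first few vertices below \<open>b\<close> at the endpoint, and after that \<open>e k\<close>, for the same reason.
\<close>

definition deep_edges :: "('i \<Rightarrow> 'v) set"
  where "deep_edges = {e\<in>edges. \<forall>j\<in>R-{a}. 2 * t \<le> card (above edges j e)}"

text \<open>The second stage counts deep edges only. Thus the \<open>t\<close> edges that determine
  the brick's side in direction \<open>a\<close> are themselves deep, and each of them reaches the
  top of the brick in every other direction.\<close>

definition core_edges :: "('i \<Rightarrow> 'v) set"
  where "core_edges = {e\<in>deep_edges. t \<le> card (above deep_edges a e)}"

definition endpoint :: "bool \<Rightarrow> 'i \<Rightarrow> 'i \<Rightarrow> 'v \<Rightarrow> 'a"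
  where "endpoint \<sigma> j k b = (if \<sigma> then U j k b else L j k b)"

text \<open>The component \<open>w k\<close> is never consulted, so with
  \<open>w = e(j := b)\<close> these candidates for \<open>e j\<close> can be computed from the
  tuple in which \<open>b\<close> replaces \<open>e j\<close> and \<open>e k\<close> is
  forgotten.\<close>

definition lower_at :: "'i \<Rightarrow> 'i \<Rightarrow> ('i \<Rightarrow> 'v) \<Rightarrow> 'a \<Rightarrow> 'v set"
  where "lower_at j k w z = {c \<in> V j. p j c < p j (w j) \<and> spans j k c z \<and>
    (\<forall>m\<in>R-{j,k}. spans j m c (p m (w m)))}"

text \<open>Candidates for \<open>e k\<close> once \<open>e j\<close> is restored; overwriting
  component \<open>k\<close> makes the set independent of \<open>w k\<close>. The case
  \<open>k = a\<close> uses deep edges because these measure the brick in direction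
  \<open>a\<close>.\<close>

definition edges_below :: "'i \<Rightarrow> ('i \<Rightarrow> 'v) \<Rightarrow> 'a \<Rightarrow> 'v set"
  where "edges_below k w z = {c \<in> V k. w(k := c) \<in> (if k = a then deep_edges else edges) \<and> p k c \<le> z}"

definition charges :: "'i \<Rightarrow> 'i \<Rightarrow> bool \<Rightarrow> ('i \<Rightarrow> 'v) \<Rightarrow> 'v \<Rightarrow> bool"
  where "charges j k \<sigma> e b \<longleftrightarrow> j \<noteq> k \<and> b \<in> V j \<and>
    (let Y = lower_at j k (e(j := b)) (endpoint \<sigma> j k b);
         Z = edges_below k e (endpoint \<sigma> j k b)
     in e j \<in> Y \<and> card {c\<in>Y. p j (e j) < p j c} \<le> 2 * t \<and>
        e k \<in> Z \<and> card {c\<in>Z. p k (e k) < p k c} \<le> 2 * t)"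

lemma deep_edges_subset: "deep_edges \<subseteq> edges" by (auto simp: deep_edges_def)

lemma core_edges_subset: "core_edges \<subseteq> deep_edges" by (auto simp: core_edges_def)

lemma core_edge_charges:
  assumes "e \<in> core_edges"
  shows "\<exists>j\<in>R. \<exists>D\<subseteq>V j. card D = t \<and> (\<forall>b\<in>D. \<exists>k\<in>R. \<exists>\<sigma>. charges j k \<sigma> e b)"
proof -
  define lo where "lo k = p k (e k)" for k
  have e_deep: "e \<in> deep_edges" and e_above: "t \<le> card (above deep_edges a e)"
    using assms by (auto simp: core_edges_def)
  then have e_edge: "e \<in> edges" using deep_edges_subset by auto
  have eP: "e \<in> PiE R V" using e_edge by (rule edgesD)
  have eV: "e k \<in> V k" if "k \<in> R" for k using eP that by auto
  have above_V: "above A j e' \<subseteq> V j" for A j e' by (auto simp: above_def)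
  have fin_V: "finite X" if "X \<subseteq> V j" "j \<in> R" for X j
    using that finite_V finite_subset by blast
  obtain h where h: "h \<in> above deep_edges a e"
    and card_h: "card {x\<in>above deep_edges a e. p a x \<le> p a h} = t"
    using initial_segment_of_card[OF fin_V[OF above_V a_in] inj_p_subset[OF a_in above_V] t_pos e_above]
    by blast
  define T where "T = {x\<in>above deep_edges a e. p a x \<le> p a h}"
  have T_deep: "e(a := c) \<in> deep_edges" if "c \<in> T" for c
    using that by (auto simp: T_def above_def)
  have T_range: "lo a \<le> p a c" "p a c \<le> p a h" if "c \<in> T" for c
    using that by (auto simp: T_def above_def lo_def)
  have h_deep: "e(a := h) \<in> deep_edges" and lo_h: "lo a < p a h"
    using h by (auto simp: above_def lo_def)
  \<comment> \<open>\<open>X j\<close> admits boxes that meet the brick's \<open>a\<close>-side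
    anywhere, not only at its corner. It thus contains the vertices above \<open>e(a := c)\<close>
    for every \<open>c\<close> in that range, and a single height \<open>hi j\<close> serves all of
    them.\<close>
  define X where "X j = {b \<in> V j. lo j < p j b \<and> (\<forall>m\<in>R-{a,j}. spans j m b (lo m)) \<and>
    (\<exists>x. lo a \<le> x \<and> x \<le> p a h \<and> spans j a b x)}" for j
  have X_V: "X j \<subseteq> V j" for j by (auto simp: X_def)
  have above_X: "above edges j (e(a := c)) \<subseteq> X j"
    if j: "j \<in> R - {a}" and c: "lo a \<le> p a c" "p a c \<le> p a h" for j c
  proof
    fix b assume "b \<in> above edges j (e(a := c))"
    then have b: "b \<in> V j" "e(a := c, j := b) \<in> edges" "lo j < p j b"
      using j by (auto simp: above_def lo_def)
    have "spans j m b (lo m)" if "m \<in> R - {a,j}" for m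
      using edgesD(2)[OF b(2), of j m] that j by (auto simp: lo_def)
    moreover have "spans j a b (p a c)"
      using edgesD(2)[OF b(2), of j a] j a_in by auto
    ultimately show "b \<in> X j" using b c by (auto simp: X_def)
  qed
  have deep_above: "2 * t \<le> card (above edges j e')" if "e' \<in> deep_edges" "j \<in> R - {a}" for e' j
    using that by (auto simp: deep_edges_def)
  have "\<forall>j\<in>R-{a}. \<exists>y. y \<in> X j \<and> card {x\<in>X j. p j x \<le> p j y} = 2 * t"
  proof
    fix j assume j: "j \<in> R - {a}"
    have "2 * t \<le> card (above edges j (e(a := e a)))" using deep_above e_deep j by simp
    also have "\<dots> \<le> card (X j)"
      using j lo_h by (intro card_mono fin_V[OF X_V] above_X) (auto simp: lo_def)
    finally show "\<exists>y. y \<in> X j \<and> card {x\<in>X j. p j x \<le> p j y} = 2 * t"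
      using initial_segment_of_card[OF fin_V[OF X_V] inj_p_subset[OF _ X_V], of j "2 * t"] j t_pos by auto
  qed
  then obtain y where y: "\<And>j. j \<in> R - {a} \<Longrightarrow> y j \<in> X j"
      "\<And>j. j \<in> R - {a} \<Longrightarrow> card {x\<in>X j. p j x \<le> p j (y j)} = 2 * t"
    by (metis bchoice)
  define hi where "hi j = (if j = a then p a h else p j (y j))" for j
  have hi_a: "hi a = p a h" by (simp add: hi_def)
  have lo_hi: "lo j \<le> hi j" if "j \<in> R" for j
    using y(1)[of j] that lo_h by (auto simp: hi_def X_def)
  \<comment> \<open>At least \<open>2 * t\<close> vertices of \<open>X j\<close> lie above the deep
    edge \<open>e(a := c)\<close>. If all of them were below \<open>y j\<close>, there would be room
    for \<open>2 * t - 1\<close> only.\<close>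
  have reach: "\<exists>b. e(a := c, j := b) \<in> edges \<and> hi j \<le> p j b"
    if j: "j \<in> R - {a}" and c: "lo a \<le> p a c" "p a c \<le> p a h" "e(a := c) \<in> deep_edges" for j c
  proof (rule ccontr)
    assume "\<not> ?thesis"
    then have "above edges j (e(a := c)) \<subseteq> {x\<in>X j. p j x \<le> p j (y j)} - {y j}"
      using above_X[OF j c(1,2)] j by (force simp: above_def hi_def)
    then have "card (above edges j (e(a := c))) \<le> card ({x\<in>X j. p j x \<le> p j (y j)} - {y j})"
      using j by (intro card_mono fin_V[of _ j]) (auto simp: X_def)
    also have "\<dots> < 2 * t"
      using y[OF j] t_pos by (subst card_Diff_singleton) auto
    finally show False using deep_above[OF c(3) j] by simp
  qed
  have e_spans: "spans k j (e k) x" if "k \<in> R" "j \<in> R" "j \<noteq> k" "lo j \<le> x" "x \<le> hi j" for k j x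
  proof -
    note asm = that
    have 1: "spans k j (e k) (lo j)" using edgesD(2)[OF e_edge, of k j] that by (simp add: lo_def)
    have "\<exists>x'. hi j \<le> x' \<and> spans k j (e k) x'"
    proof (cases "j = a")
      case True
      have "e(a := h) \<in> edges" using h_deep deep_edges_subset by auto
      from edgesD(2)[OF this, of k a] show ?thesis using that True by (auto simp: hi_def)
    next
      case False
      then obtain b where b: "e(j := b) \<in> edges" "hi j \<le> p j b"
        using reach[of j "e a"] e_deep less_imp_le[OF lo_h] asm by (auto simp: lo_def)
      from edgesD(2)[OF b(1), of k j] show ?thesis using that b(2) by auto
    qed
    then show ?thesis using spans_between[OF 1] that by (meson order_trans)
  qed
  have T_spans: "spans a j c x" if "c \<in> T" "j \<in> R - {a}" "lo j \<le> x" "x \<le> hi j" for c j x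
  proof -
    note asm = that
    have "e(a := c) \<in> edges" using T_deep that deep_edges_subset by auto
    from edgesD(2)[OF this, of a j] have 1: "spans a j c (lo j)" using that a_in by (auto simp: lo_def)
    obtain b where b: "e(a := c, j := b) \<in> edges" "hi j \<le> p j b"
      using reach[of j c] T_deep T_range asm by auto
    from edgesD(2)[OF b(1), of a j] have "spans a j c (p j b)" using that a_in by auto
    then show ?thesis using spans_between[OF 1] that b(2) by (meson order_trans)
  qed
  \<comment> \<open>\<open>touch\<close> collects the boxes that sit on the \<open>j\<close>-side of
    the brick, above its corner, and meet the brick; \<open>full\<close> collects those that also
    cross it from end to end in every other direction, which by convexity is a condition on the two
    ends.\<close>
  define touch where "touch j = {b \<in> V j. lo j < p j b \<and> p j b \<le> hi j \<and>
    (\<forall>m\<in>R-{j}. \<exists>x. lo m \<le> x \<and> x \<le> hi m \<and> spans j m b x)}" for j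
  define full where "full j = {b \<in> touch j. \<forall>m\<in>R-{j}. spans j m b (lo m) \<and> spans j m b (hi m)}" for j
  have touch_V: "touch j \<subseteq> V j" and full_V: "full j \<subseteq> V j" for j
    by (auto simp: full_def touch_def)
  \<comment> \<open>Part \<open>a\<close> already has \<open>t\<close> vertices that span the brick,
    namely \<open>T\<close>, by \<open>T_spans\<close>; \<open>t\<close> full vertices in every
    other part would make the subhypergraph complete.\<close>
  have "\<exists>j\<in>R-{a}. card (full j) < t"
  proof (rule ccontr)
    assume "\<not> ?thesis"
    then have "\<forall>j\<in>R-{a}. \<exists>S. S \<subseteq> full j \<and> card S = t"
      by (meson not_less obtain_subset_with_card_n)
    then obtain S where S: "\<And>j. j \<in> R - {a} \<Longrightarrow> S j \<subseteq> full j \<and> card (S j) = t"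
      by (metis bchoice)
    define S' where "S' = S(a := T)"
    have S'_range: "lo j \<le> p j c" "p j c \<le> hi j" if "j \<in> R" "c \<in> S' j" for j c
      using that S[of j] T_range[of c] by (auto simp: S'_def hi_a full_def touch_def split: if_splits)
    have S'_V: "S' j \<subseteq> V j \<and> card (S' j) = t" if "j \<in> R" for j
      using that S[of j] full_V[of j] card_h by (auto simp: S'_def T_def above_def)
    have "PiE R S' \<subseteq> edges"
    proof
      fix e' assume e': "e' \<in> PiE R S'"
      have "spans j k (e' j) (p k (e' k))" if jk: "j \<in> R" "k \<in> R" "j \<noteq> k" for j k
      proof (cases "j = a")
        case True
        then have "e' j \<in> T" using e' jk by (auto simp: S'_def dest: PiE_mem)
        then show ?thesis using T_spans[of "e' j" k] True jk S'_range[of k] e' by auto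
      next
        case False
        then have "e' j \<in> full j" using S[of j] PiE_mem[OF e' jk(1)] jk by (auto simp: S'_def)
        then have "spans j k (e' j) (lo k)" "spans j k (e' j) (hi k)"
          using jk by (auto simp: full_def)
        then show ?thesis using spans_between S'_range[of k "e' k"] e' jk by blast
      qed
      moreover have "e' \<in> PiE R V" using e' S'_V unfolding PiE_iff by blast
      ultimately show "e' \<in> edges" by (auto simp: edges_def)
    qed
    then show False using complete_free[of S'] S'_V by blast
  qed
  then obtain j where j: "j \<in> R - {a}" and card_full: "card (full j) < t" by blast
  have jR: "j \<in> R" "j \<noteq> a" using j by auto
  have "\<exists>x. lo m \<le> x \<and> x \<le> hi m \<and> spans j m b x" if "b \<in> X j" "m \<in> R - {j}" for b m
  proof (cases "m = a")
    case True
    then show ?thesis using that by (auto simp: X_def hi_a)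
  next
    case False
    then show ?thesis using that lo_hi[of m] by (intro exI[of _ "lo m"]) (auto simp: X_def)
  qed
  moreover have "b \<in> V j \<and> lo j < p j b" if "b \<in> X j" for b using that by (simp add: X_def)
  moreover have "hi j = p j (y j)" using jR by (simp add: hi_def)
  ultimately have "{x\<in>X j. p j x \<le> p j (y j)} \<subseteq> touch j" unfolding touch_def by auto
  then have "2 * t \<le> card (touch j)"
    using card_mono[OF fin_V[OF touch_V jR(1)]] y(2)[OF j] by metis
  moreover have "card (touch j - full j) = card (touch j) - card (full j)"
    using fin_V[OF full_V jR(1)] by (intro card_Diff_subset) (auto simp: full_def)
  ultimately have "t \<le> card (touch j - full j)" using card_full by linarith
  moreover have partial_V: "touch j - full j \<subseteq> V j" using touch_V by auto
  ultimately obtain d where card_D: "card {x \<in> touch j - full j. p j x \<le> p j d} = t"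
    using initial_segment_of_card[OF fin_V[OF partial_V jR(1)] inj_p_subset[OF jR(1) partial_V] t_pos]
    by blast
  \<comment> \<open>Taking the lowest non-spanning vertices makes everything below a member of \<open>D\<close> that meets the
    brick either spanning or in \<open>D\<close>, which bounds the ambiguity in recovering \<open>e j\<close>.\<close>
  define D where "D = {x \<in> touch j - full j. p j x \<le> p j d}"
  have D_V: "D \<subseteq> V j" using touch_V[of j] by (auto simp: D_def)
  have "\<exists>k\<in>R. \<exists>\<sigma>. charges j k \<sigma> e b" if b: "b \<in> D" for b
  proof -
    have b_touch: "b \<in> touch j" and b_d: "p j b \<le> p j d" and bV: "b \<in> V j"
      using b touch_V by (auto simp: D_def)
    obtain k where k: "k \<in> R - {j}" "\<not> (spans j k b (lo k) \<and> spans j k b (hi k))"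
      using b by (auto simp: D_def full_def)
    obtain x where x: "lo k \<le> x" "x \<le> hi k" "spans j k b x"
      using b_touch k(1) by (auto simp: touch_def)
    \<comment> \<open>The box \<open>b\<close> meets the side in direction \<open>k\<close> but
      misses one of its ends. If \<open>L j k b \<le> lo k\<close>, then \<open>b\<close> contains
      \<open>lo k\<close>, so it misses \<open>hi k\<close> and its upper endpoint is inside;
      otherwise its lower endpoint lies between \<open>lo k\<close> and \<open>x\<close>.\<close>
    obtain \<sigma> where z: "lo k \<le> endpoint \<sigma> j k b" "endpoint \<sigma> j k b \<le> hi k"
    proof (cases "L j k b \<le> lo k")
      case True
      then show ?thesis using that[of True] x k(2) by (auto simp: endpoint_def spans_def)
    next
      case False
      then show ?thesis using that[of False] x by (auto simp: endpoint_def spans_def)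
    qed
    define z where "z = endpoint \<sigma> j k b"
    have z: "lo k \<le> z" "z \<le> hi k" using z by (auto simp: z_def)
    let ?Y = "lower_at j k (e(j := b)) z"
    let ?Z = "edges_below k e z"
    have kR: "k \<in> R" "k \<noteq> j" using k by auto
    have lo_b: "lo j < p j b" using b_touch by (auto simp: touch_def)
    have "e j \<in> ?Y"
      using eV jR kR lo_b z e_spans[of j k z] edgesD(2)[OF e_edge, of j]
      by (auto simp: lower_at_def lo_def)
    moreover have "{c\<in>?Y. p j (e j) < p j c} \<subseteq> full j \<union> D"
    proof
      fix c assume "c \<in> {c\<in>?Y. p j (e j) < p j c}"
      then have c: "c \<in> V j" "lo j < p j c" "p j c < p j b" "spans j k c z"
          "\<And>m. m \<in> R - {j,k} \<Longrightarrow> spans j m c (lo m)"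
        by (auto simp: lower_at_def lo_def)
      have "p j c \<le> hi j" using c(3) b_touch by (auto simp: touch_def)
      moreover have "\<exists>x. lo m \<le> x \<and> x \<le> hi m \<and> spans j m c x" if "m \<in> R - {j}" for m
        using that c(4,5) z lo_hi by (cases "m = k") auto
      ultimately have "c \<in> touch j" using c by (auto simp: touch_def)
      then show "c \<in> full j \<union> D" using c(3) b_d by (auto simp: D_def)
    qed
    then have "card {c\<in>?Y. p j (e j) < p j c} \<le> card (full j \<union> D)"
      using full_V D_V by (intro card_mono fin_V[OF _ jR(1)] Un_least)
    then have "card {c\<in>?Y. p j (e j) < p j c} \<le> 2 * t"
      using card_Un_le[of "full j" D] card_full card_D by (simp add: D_def)
    moreover have "e k \<in> ?Z"
      using eV kR z e_deep e_edge by (auto simp: edges_below_def lo_def)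
    \<comment> \<open>Since \<open>z \<le> hi k\<close>, the edges of this line between
      \<open>e\<close> and \<open>z\<close> were counted when the height \<open>hi k\<close> was
      chosen: at most \<open>t\<close> for \<open>k = a\<close> and \<open>2 * t\<close>
      otherwise.\<close>
    moreover have "card {c\<in>?Z. p k (e k) < p k c} \<le> 2 * t"
    proof (cases "k = a")
      case True
      have "{c\<in>?Z. p k (e k) < p k c} \<subseteq> T"
        using True z hi_a by (auto simp: edges_below_def T_def above_def)
      then have "card {c\<in>?Z. p k (e k) < p k c} \<le> card T"
        by (intro card_mono fin_V[OF _ a_in]) (auto simp: T_def above_def)
      then show ?thesis using card_h by (simp add: T_def)
    next
      case False
      have "{c\<in>?Z. p k (e k) < p k c} \<subseteq> {x\<in>X k. p k x \<le> p k (y k)}"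
      proof
        fix c assume "c \<in> {c\<in>?Z. p k (e k) < p k c}"
        then have c: "e(k := c) \<in> edges" "p k c \<le> hi k" "c \<in> above edges k (e(a := e a))"
          using False z by (auto simp: edges_below_def above_def)
        then show "c \<in> {x\<in>X k. p k x \<le> p k (y k)}"
          using above_X[of k "e a"] False kR less_imp_le[OF lo_h] by (auto simp: hi_def lo_def)
      qed
      then have "card {c\<in>?Z. p k (e k) < p k c} \<le> card {x\<in>X k. p k x \<le> p k (y k)}"
        using X_V by (intro card_mono fin_V[OF _ kR(1)]) auto
      then show ?thesis using y(2)[of k] False kR by simp
    qed
    ultimately have "charges j k \<sigma> e b"
      using kR bV by (simp add: charges_def z_def[symmetric])
    then show ?thesis using kR by blast
  qed
  then show ?thesis using jR(1) card_D D_V by (intro bexI[of _ j] exI[of _ D]) (auto simp: D_def)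
qed

lemma card_charges:
  assumes j: "j \<in> R" and k: "k \<in> R" and jk: "j \<noteq> k"
  shows "card {(e, b). e \<in> core_edges \<and> charges j k \<sigma> e b} \<le> 9 * t^2 * (\<Prod>m\<in>R-{k}. card (V m))"
proof -
  define top where "top i X = {x\<in>X. card {y\<in>X. p i x < p i y} \<le> 2 * t}" for i X
  define TY where "TY w = top j (lower_at j k w (endpoint \<sigma> j k (w j)))" for w
  define TZ where "TZ w x = top k (edges_below k (w(j := x)) (endpoint \<sigma> j k (w j)))" for w x
  have fin_top: "finite (top i X)" and card_top: "card (top i X) \<le> 3 * t" if "i \<in> R" "X \<subseteq> V i" for i X
  proof -
    have fin: "finite X" using that finite_V finite_subset by blast
    then show "finite (top i X)" by (simp add: top_def)
    \<comment> \<open>At most \<open>2 * t + 1\<close> elements have rank at most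
      \<open>2 * t\<close>. Rounding up to \<open>3 * t\<close> for each of the two recoveries gives
      the factor \<open>9 * t^2\<close>.\<close>
    have "top i X = {x\<in>X. card {y\<in>X. p i x < p i y} < Suc (2 * t)}" by (auto simp: top_def)
    then have "card (top i X) \<le> Suc (2 * t)"
      using card_few_above[OF fin inj_p_subset[OF that]] by simp
    then show "card (top i X) \<le> 3 * t" using t_pos by simp
  qed
  have lower_V: "lower_at j k w z \<subseteq> V j" and below_V: "edges_below k w z \<subseteq> V k" for w z
    by (auto simp: lower_at_def edges_below_def)
  define W where "W = PiE (R-{k}) V"
  have fin_W: "finite W" unfolding W_def by (rule finite_PiE_V) auto
  let ?S = "Sigma (Sigma W TY) (\<lambda>(w, x). TZ w x)"
  have fin1: "finite (Sigma W TY)"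
    using fin_W fin_top[OF j lower_V] by (auto simp: TY_def)
  have "card {(e, b). e \<in> core_edges \<and> charges j k \<sigma> e b} \<le> 3 * t * card (Sigma W TY)"
  proof (rule card_image_Sigma_le[where T = "\<lambda>(w, x). TZ w x" and f = "\<lambda>((w, x), y). (w(j := x, k := y), w j)"])
    show "finite (Sigma W TY)" by (rule fin1)
    show "finite (case wx of (w, x) \<Rightarrow> TZ w x)" for wx
      using fin_top[OF k below_V] by (auto simp: TZ_def split: prod.split)
    show "card (case wx of (w, x) \<Rightarrow> TZ w x) \<le> 3 * t" for wx
      using card_top[OF k below_V] by (auto simp: TZ_def split: prod.split)
    show "{(e, b). e \<in> core_edges \<and> charges j k \<sigma> e b} \<subseteq> (\<lambda>((w, x), y). (w(j := x, k := y), w j)) ` ?S"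
    proof clarify
      fix e b assume e: "e \<in> core_edges" and ch: "charges j k \<sigma> e b"
      have eP: "e \<in> PiE R V"
        using e core_edges_subset deep_edges_subset edges_subset by blast
      define w where "w = restrict (e(j := b)) (R-{k})"
      have wj: "w j = b" using j jk by (simp add: w_def)
      have wk: "w(j := e j, k := c) = e(k := c)" for c
        using PiE_arb[OF eP] j k jk by (auto simp: w_def fun_eq_iff)
      have 1: "lower_at j k w z = lower_at j k (e(j := b)) z" for z
        using j jk by (auto simp: lower_at_def w_def)
      have 2: "edges_below k (w(j := e j)) z = edges_below k e z" for z
        by (simp add: edges_below_def wk)
      have "w \<in> W" using eP ch j jk by (auto simp: W_def w_def charges_def PiE_iff)
      moreover have "e j \<in> TY w" using ch by (auto simp: TY_def top_def 1 wj charges_def Let_def)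
      moreover have "e k \<in> TZ w (e j)" using ch by (auto simp: TZ_def top_def 2 wj charges_def Let_def)
      ultimately show "(e, b) \<in> (\<lambda>((w, x), y). (w(j := x, k := y), w j)) ` ?S"
        using wk[of "e k"] wj by (intro image_eqI[of _ _ "((w, e j), e k)"]) auto
    qed
  qed
  also have "card (Sigma W TY) \<le> 3 * t * card W"
    using fin_W fin_top[OF j lower_V] card_top[OF j lower_V]
    by (intro card_image_Sigma_le[where T = TY and f = "\<lambda>x. x"]) (auto simp: TY_def)
  also have "card W = (\<Prod>m\<in>R-{k}. card (V m))" using finite_R by (simp add: W_def card_PiE)
  finally show ?thesis by (simp add: power2_eq_square algebra_simps)
qed

text \<open>Double counting of the triples \<open>(e, j, b)\<close>: each core edge has at least
  \<open>t\<close> of them, and each choice of \<open>j\<close>, \<open>k\<close> and an endpoint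
  accounts for at most the bound of \<open>card_charges\<close>. The two endpoints double the 9, and
  the sum over \<open>j\<close> contributes \<open>card R\<close>.\<close>

lemma card_core_edges:
  "card core_edges \<le> 18 * card R * t * (\<Sum>k\<in>R. \<Prod>m\<in>R-{k}. card (V m))"
proof -
  let ?P = "\<lambda>k. \<Prod>m\<in>R-{k}. card (V m)"
  define Q where "Q j k \<sigma> = {(e, b). e \<in> core_edges \<and> charges j k \<sigma> e b}" for j k \<sigma>
  have fin_core: "finite core_edges"
    using finite_edges deep_edges_subset core_edges_subset by (metis finite_subset)
  have fin_Q: "finite (Q j k \<sigma>)" if "j \<in> R" for j k \<sigma>
    by (rule finite_subset[of _ "core_edges \<times> V j"])
      (use that fin_core finite_V in \<open>auto simp: Q_def charges_def\<close>)
  have card_Q: "card (Q j k \<sigma>) \<le> 9 * t^2 * ?P k" if "j \<in> R" "k \<in> R" for j k \<sigma>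
  proof (cases "j = k")
    case True
    then have "Q j k \<sigma> = {}" by (auto simp: Q_def charges_def)
    then show ?thesis by simp
  next
    case False
    then show ?thesis unfolding Q_def by (rule card_charges[OF that])
  qed
  define I where "I = R \<times> R \<times> (UNIV :: bool set)"
  have fin_I: "finite I" using finite_R by (simp add: I_def)
  define All where "All = (SIGMA e:core_edges. {(j, b). j \<in> R \<and> (\<exists>k\<in>R. \<exists>\<sigma>. charges j k \<sigma> e b)})"
  have "t * card core_edges \<le> card All"
  proof -
    have fin: "finite {(j, b). j \<in> R \<and> (\<exists>k\<in>R. \<exists>\<sigma>. charges j k \<sigma> e b)}" for e
      by (rule finite_subset[of _ "Sigma R V"]) (use finite_R finite_V in \<open>auto simp: charges_def\<close>)
    have "t \<le> card {(j, b). j \<in> R \<and> (\<exists>k\<in>R. \<exists>\<sigma>. charges j k \<sigma> e b)}" if "e \<in> core_edges" for e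
    proof -
      obtain j D where "j \<in> R" "card D = t" "\<forall>b\<in>D. \<exists>k\<in>R. \<exists>\<sigma>. charges j k \<sigma> e b"
        using core_edge_charges[OF \<open>e \<in> core_edges\<close>] by blast
      then have "Pair j ` D \<subseteq> {(j, b). j \<in> R \<and> (\<exists>k\<in>R. \<exists>\<sigma>. charges j k \<sigma> e b)}" by auto
      from card_mono[OF fin this] show ?thesis
        using \<open>card D = t\<close> by (simp add: card_image inj_on_def)
    qed
    then show ?thesis
      using fin_core fin sum_bounded_below[of core_edges t] by (simp add: All_def mult.commute)
  qed
  also have "card All \<le> card (\<Union>(j, k, \<sigma>)\<in>I. (\<lambda>(e, b). (e, j, b)) ` Q j k \<sigma>)"
    using fin_I fin_Q by (intro card_mono) (fastforce simp: All_def Q_def I_def)+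
  also have "\<dots> \<le> (\<Sum>(j, k, \<sigma>)\<in>I. card ((\<lambda>(e, b). (e, j, b)) ` Q j k \<sigma>))"
    using card_UN_le[OF fin_I, of "\<lambda>(j, k, \<sigma>). (\<lambda>(e, b). (e, j, b)) ` Q j k \<sigma>"]
    by (simp add: case_prod_unfold)
  also have "\<dots> \<le> (\<Sum>(j, k, \<sigma>)\<in>I. 9 * t^2 * ?P k)"
  proof (rule sum_mono, clarify)
    fix j k \<sigma> assume "(j, k, \<sigma>) \<in> I"
    then have "j \<in> R" "k \<in> R" by (auto simp: I_def)
    then show "card ((\<lambda>(e, b). (e, j, b)) ` Q j k \<sigma>) \<le> 9 * t^2 * ?P k"
      using card_image_le[OF fin_Q, of j "\<lambda>(e, b). (e, j, b)" k \<sigma>] card_Q[of j k \<sigma>] by linarith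
  qed
  also have "\<dots> = t * (18 * card R * t * (\<Sum>k\<in>R. ?P k))"
    by (simp add: I_def sum.cartesian_product[symmetric] sum_distrib_left power2_eq_square algebra_simps)
  finally show ?thesis using t_pos by simp
qed

text \<open>The summand 3 pays for the discarded edges: 2 for the rank threshold
  \<open>2 * t\<close> of deep edges and 1 for the threshold \<open>t\<close> of core edges.\<close>

theorem card_edges_le:
  "card edges \<le> (18 * card R + 3) * t * (\<Sum>k\<in>R. \<Prod>m\<in>R-{k}. card (V m))"
proof -
  let ?P = "\<lambda>k. \<Prod>m\<in>R-{k}. card (V m)"
  define N where "N j = {e\<in>edges. card (above edges j e) < 2 * t}" for j
  define M where "M = {e\<in>deep_edges. card (above deep_edges a e) < t}"
  have "edges \<subseteq> core_edges \<union> M \<union> (\<Union>j\<in>R. N j)"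
    by (force simp: core_edges_def deep_edges_def N_def M_def not_le)
  moreover have "finite (core_edges \<union> M \<union> (\<Union>j\<in>R. N j))"
    by (rule finite_subset[OF _ finite_edges])
      (auto simp: core_edges_def deep_edges_def N_def M_def)
  ultimately have "card edges \<le> card (core_edges \<union> M \<union> (\<Union>j\<in>R. N j))" by (rule card_mono[rotated])
  also have "\<dots> \<le> card core_edges + card M + (\<Sum>j\<in>R. card (N j))"
    using card_Un_le[of "core_edges \<union> M" "\<Union>j\<in>R. N j"] card_Un_le[of core_edges M]
      card_UN_le[OF finite_R, of N] by linarith
  also have "(\<Sum>j\<in>R. card (N j)) \<le> 2 * t * (\<Sum>k\<in>R. ?P k)"
    unfolding N_def sum_distrib_left using edges_subset
    by (intro sum_mono card_few_above_edges) auto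
  also have "card M \<le> t * ?P a"
    unfolding M_def using edges_subset deep_edges_subset a_in by (intro card_few_above_edges) auto
  also have "?P a \<le> (\<Sum>k\<in>R. ?P k)" using finite_R a_in by (intro member_le_sum) auto
  finally show ?thesis using card_core_edges by (simp add: algebra_simps)
qed

end

section \<open>Hyperedges of box families\<close>

text \<open>Hyperedges as choice functions rather than as their images.\<close>

definition crossing :: "nat \<Rightarrow> (nat \<Rightarrow> (nat \<Rightarrow> real) set multiset) \<Rightarrow> (nat \<Rightarrow> box_vertex) set"
  where "crossing r B = {e \<in> PiE {1..r} (part B). (\<Inter>j\<in>{1..r}. box_of (e j)) \<noteq> {}}"

lemma part_eq_image:
  "part B j = (\<lambda>(b, c). (j, b, c)) ` (SIGMA b:set_mset (B j). {..<count (B j) b})"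
proof -
  have "b \<in># M" if "c < count M b" for b c and M :: "(nat \<Rightarrow> real) set multiset"
    using that by (cases "b \<in># M") (auto simp: not_in_iff)
  then show ?thesis unfolding part_def by (auto simp: image_def)
qed

lemma finite_part: "finite (part B j)"
  unfolding part_eq_image by (intro finite_imageI finite_SigmaI) auto

lemma card_part: "card (part B j) = size (B j)"
proof -
  have "inj_on (\<lambda>(b, c). (j, b, c)) X" for X :: "((nat \<Rightarrow> real) set \<times> nat) set"
    by (auto simp: inj_on_def)
  then show ?thesis unfolding part_eq_image by (simp add: card_image size_multiset_overloaded_eq)
qed

lemma fst_part: "v \<in> part B j \<Longrightarrow> fst v = j" by (auto simp: part_def)

text \<open>The tags keep the parts disjoint: \<open>e j\<close> is the only element of the image
  with tag \<open>j\<close>.\<close>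

lemma inj_on_image_part: "inj_on (\<lambda>e. e ` R) (PiE R (part B))"
proof (rule inj_onI)
  fix e e' assume e: "e \<in> PiE R (part B)" and e': "e' \<in> PiE R (part B)" and eq: "e ` R = e' ` R"
  show "e = e'"
  proof (rule PiE_ext[OF e e'])
    fix j assume j: "j \<in> R"
    then have "e j \<in> e' ` R" using eq by blast
    then obtain i where i: "i \<in> R" "e j = e' i" by blast
    then have "i = j" using fst_part[OF PiE_mem[OF e j]] fst_part[OF PiE_mem[OF e' i(1)]] by simp
    then show "e j = e' j" using i by simp
  qed
qed

lemma hyperedges_eq_image: "hyperedges r B = (\<lambda>e. e ` {1..r}) ` crossing r B"
proof
  show "hyperedges r B \<subseteq> (\<lambda>e. e ` {1..r}) ` crossing r B"
  proof
    fix h assume "h \<in> hyperedges r B"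
    then obtain v where v: "h = v ` {1..r}" "\<forall>j\<in>{1..r}. v j \<in> part B j" "(\<Inter>j\<in>{1..r}. box_of (v j)) \<noteq> {}"
      by (auto simp: hyperedges_def)
    then have "restrict v {1..r} \<in> crossing r B" by (auto simp: crossing_def)
    moreover have "h = restrict v {1..r} ` {1..r}" using v(1) by auto
    ultimately show "h \<in> (\<lambda>e. e ` {1..r}) ` crossing r B" by blast
  qed
qed (auto simp: hyperedges_def crossing_def)

lemma crossing_subset: "crossing r B \<subseteq> PiE {1..r} (part B)" by (auto simp: crossing_def)

lemma finite_crossing: "finite (crossing r B)"
  by (rule finite_subset[OF crossing_subset]) (intro finite_PiE finite_atLeastAtMost finite_part)

lemma card_hyperedges: "card (hyperedges r B) = card (crossing r B)"
  unfolding hyperedges_eq_image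
  by (rule card_image[OF inj_on_subset[OF inj_on_image_part crossing_subset]])

lemma contains_complete_iff:
  "contains_complete r t B \<longleftrightarrow>
    (\<exists>S. (\<forall>j\<in>{1..r}. S j \<subseteq> part B j \<and> card (S j) = t) \<and> PiE {1..r} S \<subseteq> crossing r B)"
proof -
  have "(\<forall>v. (\<forall>j\<in>{1..r}. v j \<in> S j) \<longrightarrow> v ` {1..r} \<in> hyperedges r B) \<longleftrightarrow> PiE {1..r} S \<subseteq> crossing r B"
    if S: "\<forall>j\<in>{1..r}. S j \<subseteq> part B j" for S
  proof
    assume *: "\<forall>v. (\<forall>j\<in>{1..r}. v j \<in> S j) \<longrightarrow> v ` {1..r} \<in> hyperedges r B"
    show "PiE {1..r} S \<subseteq> crossing r B"
    proof
      fix e assume e: "e \<in> PiE {1..r} S"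
      then have eP: "e \<in> PiE {1..r} (part B)" using S by (auto simp: PiE_iff)
      have "e ` {1..r} \<in> hyperedges r B" using * e by auto
      then obtain e' where e': "e' \<in> crossing r B" "e ` {1..r} = e' ` {1..r}"
        by (auto simp: hyperedges_eq_image)
      moreover have "e' \<in> PiE {1..r} (part B)" using e'(1) crossing_subset by blast
      ultimately have "e = e'" using inj_onD[OF inj_on_image_part e'(2) eP] by blast
      then show "e \<in> crossing r B" using e'(1) by simp
    qed
  next
    assume *: "PiE {1..r} S \<subseteq> crossing r B"
    show "\<forall>v. (\<forall>j\<in>{1..r}. v j \<in> S j) \<longrightarrow> v ` {1..r} \<in> hyperedges r B"
    proof (intro allI impI)
      fix v assume "\<forall>j\<in>{1..r}. v j \<in> S j"
      then have "restrict v {1..r} \<in> crossing r B" using * by auto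
      moreover have "v ` {1..r} = restrict v {1..r} ` {1..r}" by auto
      ultimately show "v ` {1..r} \<in> hyperedges r B" unfolding hyperedges_eq_image by blast
    qed
  qed
  then show ?thesis unfolding contains_complete_def by blast
qed

section \<open>The extremal function as a maximum\<close>

lemma card_hyperedges_le_prod:
  fixes B :: "nat \<Rightarrow> (nat \<Rightarrow> real) set multiset"
  shows "card (hyperedges r B) \<le> (\<Prod>j\<in>{1..r}. size (B j))"
proof -
  have "card (crossing r B) \<le> card (PiE {1..r} (part B))"
    by (rule card_mono[OF _ crossing_subset]) (intro finite_PiE finite_atLeastAtMost finite_part)
  then show ?thesis by (simp add: card_hyperedges card_PiE card_part)
qed

lemma finite_zarankiewicz_values:
  "finite {card (hyperedges r B) | B.
     box_family d r F B \<and> (\<forall>j\<in>{1..r}. size (B j) = n j) \<and> \<not> contains_complete r t B}"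
proof (rule finite_subset)
  show "{card (hyperedges r B) | B.
     box_family d r F B \<and> (\<forall>j\<in>{1..r}. size (B j) = n j) \<and> \<not> contains_complete r t B}
     \<subseteq> {..\<Prod>j\<in>{1..r}. n j}"
  proof
    fix x assume "x \<in> {card (hyperedges r B) | B.
     box_family d r F B \<and> (\<forall>j\<in>{1..r}. size (B j) = n j) \<and> \<not> contains_complete r t B}"
    then obtain B where B: "x = card (hyperedges r B)" "\<forall>j\<in>{1..r}. size (B j) = n j" by blast
    then have "(\<Prod>j\<in>{1..r}. size (B j)) = (\<Prod>j\<in>{1..r}. n j)" by simp
    then show "x \<in> {..\<Prod>j\<in>{1..r}. n j}"
      using card_hyperedges_le_prod[of r B] B(1) by simp
  qed
qed simp

lemma zarankiewicz_ge:
  assumes "box_family d r F B" "\<And>j. j \<in> {1..r} \<Longrightarrow> size (B j) = n j" "\<not> contains_complete r t B"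
  shows "card (hyperedges r B) \<le> zarankiewicz d r F n t"
  unfolding zarankiewicz_def using assms by (intro Max_ge finite_zarankiewicz_values) auto

text \<open>\<open>Max\<close> of an empty set is unspecified, so an upper bound has to come with a
  witness \<open>B0\<close>.\<close>

lemma zarankiewicz_le:
  assumes "box_family d r F B0" "\<And>j. j \<in> {1..r} \<Longrightarrow> size (B0 j) = n j" "\<not> contains_complete r t B0"
    and "\<And>B. box_family d r F B \<Longrightarrow> (\<And>j. j \<in> {1..r} \<Longrightarrow> size (B j) = n j) \<Longrightarrow>
      \<not> contains_complete r t B \<Longrightarrow> card (hyperedges r B) \<le> N"
  shows "zarankiewicz d r F n t \<le> N"
  unfolding zarankiewicz_def
proof (rule Max.boundedI[OF finite_zarankiewicz_values])
  show "{card (hyperedges r B) | B.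
     box_family d r F B \<and> (\<forall>j\<in>{1..r}. size (B j) = n j) \<and> \<not> contains_complete r t B} \<noteq> {}"
    using assms(1-3) by auto
qed (use assms(4) in auto)

text \<open>The copies of a box \<open>b\<close> in the image multiset are as many as the indices
  that \<open>f\<close> sends to \<open>b\<close>, so they can be matched one fibre at a
  time.\<close>

lemma ex_bij_betw_copies:
  fixes j :: 'j and f :: "'i \<Rightarrow> 'b"
  assumes "finite I"
  shows "\<exists>\<phi>. bij_betw \<phi> {(j, b, c) | b c. c < count (image_mset f (mset_set I)) b} I \<and>
    (\<forall>b c. c < count (image_mset f (mset_set I)) b \<longrightarrow> f (\<phi> (j, b, c)) = b)"
proof -
  let ?M = "image_mset f (mset_set I)"
  have count: "count ?M b = card {i\<in>I. f i = b}" for b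
  proof -
    have "count ?M b = card (f -` {b} \<inter> I)"
      using assms by (simp add: count_image_mset)
    also have "f -` {b} \<inter> I = {i\<in>I. f i = b}" by auto
    finally show ?thesis .
  qed
  have "\<forall>b. \<exists>g. bij_betw g {0..<count ?M b} {i\<in>I. f i = b}"
    using assms by (auto simp: count intro!: ex_bij_betw_nat_finite)
  then obtain g where g: "\<And>b. bij_betw (g b) {0..<count ?M b} {i\<in>I. f i = b}" by metis
  have g_mem: "g b c \<in> I" "f (g b c) = b" if "c < count ?M b" for b c
    using bij_betw_apply[OF g, of c b] that by auto
  define \<phi> where "\<phi> v = g (fst (snd v)) (snd (snd v))" for v :: "'j \<times> 'b \<times> nat"
  have "bij_betw \<phi> {(j, b, c) | b c. c < count ?M b} I"
    unfolding bij_betw_def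
  proof
    show "inj_on \<phi> {(j, b, c) | b c. c < count ?M b}"
    proof (rule inj_onI)
      fix v v' assume "v \<in> {(j, b, c) | b c. c < count ?M b}" "v' \<in> {(j, b, c) | b c. c < count ?M b}"
        and eq: "\<phi> v = \<phi> v'"
      then obtain b c b' c' where v: "v = (j, b, c)" "c < count ?M b" "v' = (j, b', c')" "c' < count ?M b'"
        by auto
      have b: "b = b'" using g_mem(2)[OF v(2)] g_mem(2)[OF v(4)] eq v by (simp add: \<phi>_def)
      then have "g b c = g b c'" using eq v by (simp add: \<phi>_def)
      then have "c = c'" using inj_onD[OF bij_betw_imp_inj_on[OF g]] v b by auto
      then show "v = v'" using v b by simp
    qed
    show "\<phi> ` {(j, b, c) | b c. c < count ?M b} = I"
    proof
      show "\<phi> ` {(j, b, c) | b c. c < count ?M b} \<subseteq> I" using g_mem by (auto simp: \<phi>_def)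
      show "I \<subseteq> \<phi> ` {(j, b, c) | b c. c < count ?M b}"
      proof
        fix i assume "i \<in> I"
        then have "i \<in> g (f i) ` {0..<count ?M (f i)}"
          using bij_betw_imp_surj_on[OF g, of "f i"] by simp
        then obtain c where "c < count ?M (f i)" "i = g (f i) c" by auto
        then show "i \<in> \<phi> ` {(j, b, c) | b c. c < count ?M b}"
          by (intro image_eqI[of _ _ "(j, f i, c)"]) (auto simp: \<phi>_def)
      qed
    qed
  qed
  then show ?thesis using g_mem(2) by (intro exI[of _ \<phi>]) (auto simp: \<phi>_def)
qed

text \<open>Lets a construction name its boxes by indices below \<open>n\<close>; equal boxes at
  different indices become different copies in the multiset.\<close>

lemma indexed_box_family:
  assumes f: "\<And>j i. j \<in> {1..r} \<Longrightarrow> i < n \<Longrightarrow> f j i \<in> boxes_with_directions d (F j)"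
    and free: "\<And>S. (\<And>j. j \<in> {1..r} \<Longrightarrow> S j \<subseteq> {..<n} \<and> card (S j) = t) \<Longrightarrow>
      \<exists>e\<in>PiE {1..r} S. (\<Inter>j\<in>{1..r}. f j (e j)) = {}"
  obtains B where "box_family d r F B" "\<forall>j\<in>{1..r}. size (B j) = n"
    "\<not> contains_complete r t B"
    "card {e \<in> PiE {1..r} (\<lambda>_. {..<n}). (\<Inter>j\<in>{1..r}. f j (e j)) \<noteq> {}} \<le> card (hyperedges r B)"
proof -
  let ?R = "{1..r}"
  define B where "B j = image_mset (f j) (mset_set {..<n})" for j
  have "\<forall>j. \<exists>\<phi>. bij_betw \<phi> (part B j) {..<n} \<and> (\<forall>v\<in>part B j. f j (\<phi> v) = box_of v)"
  proof
    fix j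
    obtain \<phi> where "bij_betw \<phi> {(j, b, c) | b c. c < count (B j) b} {..<n}"
      "\<forall>b c. c < count (B j) b \<longrightarrow> f j (\<phi> (j, b, c)) = b"
      using ex_bij_betw_copies[of "{..<n}" j "f j"] unfolding B_def by auto
    then show "\<exists>\<phi>. bij_betw \<phi> (part B j) {..<n} \<and> (\<forall>v\<in>part B j. f j (\<phi> v) = box_of v)"
      by (intro exI[of _ \<phi>]) (auto simp: part_def box_of_def)
  qed
  then obtain \<phi> where \<phi>: "\<And>j. bij_betw (\<phi> j) (part B j) {..<n}"
      "\<And>j v. v \<in> part B j \<Longrightarrow> f j (\<phi> j v) = box_of v" by metis
  define \<psi> where "\<psi> j = inv_into (part B j) (\<phi> j)" for j
  have \<psi>_part: "\<psi> j i \<in> part B j" and \<phi>_\<psi>: "\<phi> j (\<psi> j i) = i" if "i < n" for i j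
    using that \<phi>(1)[of j] unfolding \<psi>_def
    by (auto simp: bij_betw_def intro: inv_into_into f_inv_into_f)
  have \<psi>_\<phi>: "\<psi> j (\<phi> j v) = v" if "v \<in> part B j" for v j
    using that \<phi>(1)[of j] by (simp add: \<psi>_def bij_betw_def)
  have box_\<psi>: "box_of (\<psi> j i) = f j i" if "i < n" for i j
    using \<phi>(2)[OF \<psi>_part[OF that]] \<phi>_\<psi>[OF that] by simp
  define \<Psi> where "\<Psi> e = restrict (\<lambda>j. \<psi> j (e j)) ?R" for e
  show ?thesis
  proof
    show "box_family d r F B" using f by (auto simp: box_family_def B_def)
    show "\<forall>j\<in>?R. size (B j) = n" by (simp add: B_def)
    show "\<not> contains_complete r t B"
    proof
      assume "contains_complete r t B"
      then obtain S where S: "\<forall>j\<in>?R. S j \<subseteq> part B j \<and> card (S j) = t" "PiE ?R S \<subseteq> crossing r B"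
        by (auto simp: contains_complete_iff)
      have "\<phi> j ` S j \<subseteq> {..<n} \<and> card (\<phi> j ` S j) = t" if "j \<in> ?R" for j
      proof -
        have "inj_on (\<phi> j) (S j)"
          using \<phi>(1)[of j] S(1) that by (meson bij_betw_imp_inj_on inj_on_subset)
        moreover have "\<phi> j ` S j \<subseteq> \<phi> j ` part B j" using S(1) that by blast
        ultimately show ?thesis
          using S(1) that bij_betw_imp_surj_on[OF \<phi>(1)[of j]] by (simp add: card_image)
      qed
      then obtain e where e: "e \<in> PiE ?R (\<lambda>j. \<phi> j ` S j)" "(\<Inter>j\<in>?R. f j (e j)) = {}"
        using free[of "\<lambda>j. \<phi> j ` S j"] by blast
      have e_n: "e j < n" and \<psi>_S: "\<psi> j (e j) \<in> S j" if "j \<in> ?R" for j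
      proof -
        have "e j \<in> \<phi> j ` S j" using e(1) that by (auto simp: PiE_iff)
        then obtain v where v: "v \<in> S j" "e j = \<phi> j v" by auto
        then have "v \<in> part B j" using S(1) that by auto
        then show "e j < n" "\<psi> j (e j) \<in> S j"
          using v \<psi>_\<phi> bij_betw_apply[OF \<phi>(1)[of j]] by auto
      qed
      have "\<Psi> e \<in> PiE ?R S" using \<psi>_S by (auto simp: \<Psi>_def)
      then have "(\<Inter>j\<in>?R. box_of (\<Psi> e j)) \<noteq> {}" using S(2) by (auto simp: crossing_def)
      also have "(\<Inter>j\<in>?R. box_of (\<Psi> e j)) = (\<Inter>j\<in>?R. f j (e j))"
        by (rule INF_cong) (simp_all add: \<Psi>_def box_\<psi> e_n)
      finally show False using e(2) by simp
    qed
    show "card {e \<in> PiE ?R (\<lambda>_. {..<n}). (\<Inter>j\<in>?R. f j (e j)) \<noteq> {}} \<le> card (hyperedges r B)"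
      unfolding card_hyperedges
    proof (rule card_inj_on_le[of \<Psi>])
      show "inj_on \<Psi> {e \<in> PiE ?R (\<lambda>_. {..<n}). (\<Inter>j\<in>?R. f j (e j)) \<noteq> {}}"
      proof (rule inj_onI)
        fix e e' assume e: "e \<in> {e \<in> PiE ?R (\<lambda>_. {..<n}). (\<Inter>j\<in>?R. f j (e j)) \<noteq> {}}"
          "e' \<in> {e \<in> PiE ?R (\<lambda>_. {..<n}). (\<Inter>j\<in>?R. f j (e j)) \<noteq> {}}" and eq: "\<Psi> e = \<Psi> e'"
        then have P: "e \<in> PiE ?R (\<lambda>_. {..<n})" "e' \<in> PiE ?R (\<lambda>_. {..<n})" by auto
        show "e = e'"
        proof (rule PiE_ext[OF P])
          fix j assume j: "j \<in> ?R"
          then have "\<psi> j (e j) = \<psi> j (e' j)" using fun_cong[OF eq, of j] by (simp add: \<Psi>_def)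
          moreover have "e j < n" "e' j < n" using PiE_mem[OF P(1) j] PiE_mem[OF P(2) j] by auto
          ultimately show "e j = e' j" using \<phi>_\<psi> by metis
        qed
      qed
      show "\<Psi> ` {e \<in> PiE ?R (\<lambda>_. {..<n}). (\<Inter>j\<in>?R. f j (e j)) \<noteq> {}} \<subseteq> crossing r B"
      proof clarify
        fix e assume e: "e \<in> PiE ?R (\<lambda>_. {..<n})" "(\<Inter>j\<in>?R. f j (e j)) \<noteq> {}"
        have e_n: "e j < n" if "j \<in> ?R" for j using PiE_mem[OF e(1) that] by simp
        have "(\<Inter>j\<in>?R. box_of (\<Psi> e j)) = (\<Inter>j\<in>?R. f j (e j))"
          by (rule INF_cong) (simp_all add: \<Psi>_def box_\<psi> e_n)
        moreover have "\<Psi> e \<in> PiE ?R (part B)" using e_n \<psi>_part by (auto simp: \<Psi>_def)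
        ultimately show "\<Psi> e \<in> crossing r B" using e(2) by (simp add: crossing_def)
      qed
    qed (rule finite_crossing)
  qed
qed

section \<open>Points and lines in digit vectors\<close>

text \<open>The digit reversal behind the van der Corput sequence, restricted to the lowest
  \<open>k\<close> digits: the lowest digit of \<open>x\<close> becomes the leading one, and digits
  from position \<open>k\<close> on are ignored.\<close>

fun digit_rev :: "nat \<Rightarrow> nat \<Rightarrow> nat \<Rightarrow> nat"
  where "digit_rev b 0 x = 0"
  | "digit_rev b (Suc k) x = (x mod b) * b ^ k + digit_rev b k (x div b)"

lemma digit_rev_less: "0 < b \<Longrightarrow> digit_rev b k x < b ^ k"
proof (induction k arbitrary: x)
  case (Suc k)
  have "digit_rev b (Suc k) x < (x mod b) * b ^ k + b ^ k" using Suc by simp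
  also have "\<dots> = Suc (x mod b) * b ^ k" by simp
  also have "\<dots> \<le> b * b ^ k" using Suc.prems by (intro mult_right_mono) (auto simp: Suc_le_eq)
  finally show ?case by simp
qed simp

lemma digit_rev_add:
  "digit_rev b (s + m) x = digit_rev b s x * b ^ m + digit_rev b m (x div b ^ s)"
  by (induction s arbitrary: x) (simp_all add: power_add algebra_simps div_mult2_eq)

text \<open>Cutting off low digits of the reversed number cuts off high digits of \<open>x\<close>.
  Prescribing the lowest \<open>s\<close> digits of \<open>x\<close> therefore confines its reversal
  to an interval.\<close>

lemma digit_rev_div:
  assumes "0 < b" "s \<le> k"
  shows "digit_rev b k x div b ^ (k - s) = digit_rev b s x"
proof -
  have "digit_rev b k x = digit_rev b s x * b ^ (k - s) + digit_rev b (k - s) (x div b ^ s)"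
    using digit_rev_add[of b s "k - s" x] assms(2) by simp
  then show ?thesis using digit_rev_less[OF assms(1), of "k - s" "x div b ^ s"] assms(1) by simp
qed

lemma digit_rev_eq_iff:
  assumes "0 < b"
  shows "digit_rev b s x = digit_rev b s y \<longleftrightarrow> x mod b ^ s = y mod b ^ s"
proof (induction s arbitrary: x y)
  case (Suc s)
  have 1: "x mod b ^ Suc s = b * (x div b mod b ^ s) + x mod b" for x
    by (simp add: mod_mult2_eq)
  have "digit_rev b (Suc s) x = digit_rev b (Suc s) y \<longleftrightarrow>
      x mod b = y mod b \<and> digit_rev b s (x div b) = digit_rev b s (y div b)"
  proof
    assume eq: "digit_rev b (Suc s) x = digit_rev b (Suc s) y"
    have "digit_rev b (Suc s) z div b ^ s = z mod b" for z
      using digit_rev_less[OF assms, of s "z div b"] assms by simp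
    then have "x mod b = y mod b" using eq by metis
    then show "x mod b = y mod b \<and> digit_rev b s (x div b) = digit_rev b s (y div b)" using eq by simp
  qed simp
  also have "\<dots> \<longleftrightarrow> x mod b ^ Suc s = y mod b ^ Suc s"
  proof
    assume eq: "x mod b ^ Suc s = y mod b ^ Suc s"
    then have "x mod b ^ Suc s mod b = y mod b ^ Suc s mod b" by simp
    then have "x mod b = y mod b" by (simp add: mod_mod_cancel)
    then show "x mod b = y mod b \<and> digit_rev b s (x div b) = digit_rev b s (y div b)"
      using eq Suc assms by (simp add: 1 del: power_Suc)
  next
    assume "x mod b = y mod b \<and> digit_rev b s (x div b) = digit_rev b s (y div b)"
    then show "x mod b ^ Suc s = y mod b ^ Suc s" using Suc by (simp add: 1 del: power_Suc)
  qed
  finally show ?case .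
qed simp

text \<open>
  Numbers are read as digit vectors in base \<open>b\<close>. The pair consisting of \<open>s = g mod b\<close> and \<open>g div b\<close>
  encodes the combinatorial line of all \<open>q\<close> whose digits other than digit \<open>s\<close> are prescribed. Placing
  \<open>q\<close> at the point with coordinates \<open>q\<close> and \<open>digit_rev b b q\<close> turns each line into a rectangle,
  since the digits above \<open>s\<close> are leading digits of the first coordinate and the digits below \<open>s\<close> are
  leading digits of the second.
\<close>

definition on_line :: "nat \<Rightarrow> nat \<Rightarrow> nat \<Rightarrow> bool"
  where "on_line b q g \<longleftrightarrow>
    q div b ^ Suc (g mod b) = g div b div b ^ (g mod b) \<and>
    q mod b ^ (g mod b) = g div b mod b ^ (g mod b)"

text \<open>Digit \<open>s\<close> is deleted and the position \<open>s\<close> itself is appended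
  as the new lowest digit. Positions are digits because there are \<open>b\<close> of them, so lines
  are numbered within the same range as points.\<close>

definition line :: "nat \<Rightarrow> nat \<Rightarrow> nat \<Rightarrow> nat"
  where "line b q s = (q div b ^ Suc s * b ^ s + q mod b ^ s) * b + s"

text \<open>\<open>line_x\<close> and \<open>line_y\<close> give the lower left corner of the
  rectangle of a line: the prescribed leading digits of the respective coordinate, followed by
  zeros.\<close>

definition line_x :: "nat \<Rightarrow> nat \<Rightarrow> nat"
  where "line_x b g = g div b div b ^ (g mod b) * b ^ Suc (g mod b)"

definition line_y :: "nat \<Rightarrow> nat \<Rightarrow> nat"
  where "line_y b g = digit_rev b (g mod b) (g div b) * b ^ (b - g mod b)"

lemma div_nat_eq_iff:
  fixes n D k :: nat
  assumes "0 < D"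
  shows "n div D = k \<longleftrightarrow> k * D \<le> n \<and> n < k * D + D"
  using assms by (metis add.commute div_nat_eqI dividend_less_div_times mult.commute mult_Suc
      times_div_less_eq_dividend)

lemma on_line_iff:
  assumes "0 < b"
  shows "on_line b q g \<longleftrightarrow>
    line_x b g \<le> q \<and> q < line_x b g + b ^ Suc (g mod b) \<and>
    line_y b g \<le> digit_rev b b q \<and> digit_rev b b q < line_y b g + b ^ (b - g mod b)"
proof -
  let ?s = "g mod b"
  have "?s \<le> b" using assms by (simp add: less_imp_le)
  have "q mod b ^ ?s = g div b mod b ^ ?s \<longleftrightarrow> digit_rev b b q div b ^ (b - ?s) = digit_rev b ?s (g div b)"
    using digit_rev_eq_iff[OF assms] digit_rev_div[OF assms \<open>?s \<le> b\<close>] by simp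
  also have "\<dots> \<longleftrightarrow> line_y b g \<le> digit_rev b b q \<and> digit_rev b b q < line_y b g + b ^ (b - ?s)"
    unfolding line_y_def using assms by (intro div_nat_eq_iff) simp
  finally show ?thesis
    unfolding on_line_def using div_nat_eq_iff[of "b ^ Suc ?s" q] assms by (simp add: line_x_def)
qed

text \<open>If the free positions satisfy \<open>s < s'\<close>, the second line prescribes digit
  \<open>s\<close> and the first one all other digits, so the points agree. If the free positions
  are equal, any common point determines the line.\<close>

lemma on_line_unique:
  assumes "0 < b" "on_line b q g" "on_line b q' g" "on_line b q g'" "on_line b q' g'"
  shows "q = q' \<or> g = g'"
proof -
  have less: "q = q'"
    if "on_line b q g" "on_line b q' g" "on_line b q g'" "on_line b q' g'" "g mod b < g' mod b" for g g'
  proof -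
    let ?s = "g mod b" and ?s' = "g' mod b"
    have "b ^ Suc ?s dvd b ^ ?s'" using that(5) by (intro le_imp_power_dvd) simp
    moreover have "q mod b ^ ?s' mod b ^ Suc ?s = q' mod b ^ ?s' mod b ^ Suc ?s"
      using that(3,4) by (simp add: on_line_def)
    ultimately have "q mod b ^ Suc ?s = q' mod b ^ Suc ?s" by (simp add: mod_mod_cancel)
    moreover have "q div b ^ Suc ?s = q' div b ^ Suc ?s" using that(1,2) by (simp add: on_line_def)
    ultimately show ?thesis by (metis div_mod_decomp)
  qed
  consider "g mod b < g' mod b" | "g' mod b < g mod b" | "g mod b = g' mod b" by linarith
  then show ?thesis
  proof cases
    case 3
    then have "g div b div b ^ (g mod b) = g' div b div b ^ (g mod b)"
      "g div b mod b ^ (g mod b) = g' div b mod b ^ (g mod b)"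
      using assms(2,4) by (simp_all add: on_line_def)
    then have "g div b = g' div b" by (metis div_mod_decomp)
    then show ?thesis using 3 by (metis div_mod_decomp)
  qed (use less assms in auto)
qed

section \<open>The lines through a point and the number of incidences\<close>

lemma line_mod: "s < b \<Longrightarrow> line b q s mod b = s"
  and line_div: "s < b \<Longrightarrow> line b q s div b = q div b ^ Suc s * b ^ s + q mod b ^ s"
  by (simp_all add: line_def)

lemma on_line_line: "s < b \<Longrightarrow> on_line b q (line b q s)"
  unfolding on_line_def line_mod line_div by simp

text \<open>\<open>M\<close> is a multiple of \<open>b ^ Suc s\<close>, so exchanging one of the
  lowest digits for another cannot leave the range. Digits from position \<open>b\<close> on merely
  number disjoint copies of the configuration.\<close>

lemma line_less:
  assumes "b ^ b dvd M" "q < M" "s < b"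
  shows "line b q s < M"
proof -
  have b: "0 < b" using assms(3) by simp
  obtain m where m: "M = b ^ Suc s * m"
    using assms(1,3) by (metis dvd_def le_imp_power_dvd dvd_trans Suc_leI)
  have "q div b ^ Suc s < m" using assms(2) m b by (simp add: less_mult_imp_div_less mult.commute)
  have "line b q s < (q div b ^ Suc s * b ^ s + q mod b ^ s) * b + b" using assms(3) by (simp add: line_def)
  also have "\<dots> = Suc (q div b ^ Suc s * b ^ s + q mod b ^ s) * b" by simp
  also have "\<dots> \<le> (q div b ^ Suc s * b ^ s + b ^ s) * b"
    using b by (intro mult_right_mono) (auto simp: Suc_le_eq)
  also have "\<dots> = Suc (q div b ^ Suc s) * b ^ Suc s" by (simp add: algebra_simps)
  also have "\<dots> \<le> m * b ^ Suc s" using \<open>q div b ^ Suc s < m\<close> by (intro mult_right_mono) auto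
  finally show ?thesis by (simp add: m mult.commute)
qed

text \<open>Division by \<open>u\<close> identifies the \<open>u\<close> copies of a point or a
  line. Each of the \<open>M\<close> points lies on \<open>b\<close> lines, and each incidence
  yields \<open>u * u\<close> pairs of copies.\<close>

lemma card_on_line_ge:
  assumes "0 < u" "b ^ b dvd M" "u * M \<le> n"
  shows "u * u * M * b \<le> card {(i, i'). i < n \<and> i' < n \<and> on_line b (i div u) (i' div u)}"
proof -
  let ?f = "\<lambda>(q, s, \<alpha>, \<beta>). (q * u + \<alpha>, line b q s * u + \<beta>)"
  let ?A = "{..<M} \<times> {..<b} \<times> {..<u} \<times> {..<u}"
  have less: "q * u + \<alpha> < n" if "q < M" "\<alpha> < u" for q \<alpha>
  proof -
    have "q * u + \<alpha> < Suc q * u" using that by simp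
    also have "\<dots> \<le> M * u" using that by (intro mult_right_mono) auto
    finally show ?thesis using assms(3) by (simp add: mult.commute)
  qed
  have "card ?A \<le> card {(i, i'). i < n \<and> i' < n \<and> on_line b (i div u) (i' div u)}"
  proof (rule card_inj_on_le)
    show "inj_on ?f ?A"
    proof (rule inj_onI)
      fix v w assume vw: "v \<in> ?A" "w \<in> ?A" "?f v = ?f w"
      obtain q s \<alpha> \<beta> where v: "v = (q, s, \<alpha>, \<beta>)" by (metis prod_cases4)
      obtain q' s' \<alpha>' \<beta>' where w: "w = (q', s', \<alpha>', \<beta>')" by (metis prod_cases4)
      have lt: "\<alpha> < u" "\<beta> < u" "\<alpha>' < u" "\<beta>' < u" "s < b" "s' < b" using vw by (auto simp: v w)
      have eq: "q * u + \<alpha> = q' * u + \<alpha>'" "line b q s * u + \<beta> = line b q' s' * u + \<beta>'"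
        using vw(3) by (simp_all add: v w)
      have 1: "(x * u + y) div u = x" "(x * u + y) mod u = y" if "y < u" for x y using that by auto
      have "q = q'" "\<alpha> = \<alpha>'" using eq(1) 1 lt by metis+
      moreover have "line b q s = line b q' s'" "\<beta> = \<beta>'" using eq(2) 1 lt by metis+
      moreover from this have "s = s'" using line_mod lt by metis
      ultimately show "v = w" by (simp add: v w)
    qed
    show "?f ` ?A \<subseteq> {(i, i'). i < n \<and> i' < n \<and> on_line b (i div u) (i' div u)}"
      using less line_less[OF assms(2)] on_line_line by auto
    show "finite {(i, i'). i < n \<and> i' < n \<and> on_line b (i div u) (i' div u)}"
      by (rule finite_subset[of _ "{..<n} \<times> {..<n}"]) auto
  qed
  then show ?thesis by (simp add: card_cartesian_product algebra_simps)
qed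

lemma ex_div_neq:
  fixes S :: "nat set"
  assumes "0 < u" "u < card S"
  shows "\<exists>i\<in>S. \<exists>i'\<in>S. i div u \<noteq> i' div u"
proof (rule ccontr)
  assume *: "\<not> ?thesis"
  obtain i where i: "i \<in> S" using assms by fastforce
  have "S \<subseteq> {i div u * u..<i div u * u + u}"
  proof
    fix i' assume "i' \<in> S"
    then have "i' div u = i div u" using * i by blast
    then show "i' \<in> {i div u * u..<i div u * u + u}"
      using div_nat_eq_iff[OF assms(1), of i' "i div u"] by simp
  qed
  then have "card S \<le> u" using card_mono[of "{i div u * u..<i div u * u + u}" S] by simp
  then show False using assms by simp
qed

text \<open>The constant 8 consists of three factors 2: one in the choice of \<open>x\<close>, one
  for rounding \<open>x\<close> down to \<open>b\<close>, and one for rounding \<open>n\<close> down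
  to a multiple of \<open>u * b ^ b\<close>.\<close>

lemma eventually_ex_base:
  assumes "0 < u"
  shows "\<forall>\<^sub>F n in sequentially. \<exists>b M. 0 < b \<and> b ^ b dvd M \<and> u * M \<le> n \<and>
    real n * (ln (real n) / ln (ln (real n))) / 8 \<le> real (u * M * b)"
proof -
  have "\<forall>\<^sub>F n in sequentially. 1 \<le> ln (real n) / (2 * ln (ln (real n)))" by real_asymp
  moreover have "\<forall>\<^sub>F n in sequentially. 1 \<le> 2 * ln (ln (real n))" by real_asymp
  moreover have "\<forall>\<^sub>F n in sequentially. 1 \<le> ln (real n)" by real_asymp
  moreover have "\<forall>\<^sub>F n in sequentially. u^2 \<le> n" by (rule eventually_ge_at_top)
  ultimately show ?thesis
  proof eventually_elim
    case (elim n)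
    let ?l = "ln (real n)" and ?ll = "ln (ln (real n))"
    \<comment> \<open>The 2 in the denominator makes \<open>b ^ b\<close> at most the square root of
      \<open>n\<close>. Since \<open>u\<close> is eventually below that root too,
      \<open>u * b ^ b\<close> fits into \<open>n\<close>.\<close>
    define x where "x = ?l / (2 * ?ll)"
    define b where "b = nat \<lfloor>x\<rfloor>"
    have n: "0 < n" using elim(3) by (cases "n = 0") auto
    have x1: "1 \<le> x" using elim(1) by (simp add: x_def)
    have b_le: "real b \<le> x" using x1 by (simp add: b_def)
    have "x - 1 < real b" using x1 unfolding b_def by linarith
    moreover have b_pos: "0 < b" using x1 by (simp add: b_def)
    ultimately have b_ge: "x / 2 \<le> real b" by linarith
    have "x \<le> ?l" using elim(2,3) by (simp add: x_def divide_le_eq mult_le_cancel_left1)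
    then have "real b \<le> ?l" using b_le by simp
    then have "ln (real b) \<le> ?ll" using b_pos by simp
    then have "real b * ln (real b) \<le> x * ?ll"
      using b_le b_pos elim(2) by (intro mult_mono) auto
    also have "\<dots> = ?l / 2" using elim(2) by (simp add: x_def)
    finally have "2 * (real b * ln (real b)) \<le> ?l" by simp
    then have "ln (real ((b ^ b)^2)) \<le> ln (real n)" using b_pos by (simp add: ln_realpow)
    then have bb: "(b ^ b)^2 \<le> n" using b_pos n by (simp add: of_nat_le_iff[symmetric, where 'a = real] del: of_nat_le_iff of_nat_power)
    define K where "K = u * b ^ b"
    have "K^2 \<le> n^2"
      using mult_mono[OF elim(4) bb] by (simp add: K_def power2_eq_square ac_simps)
    then have K: "K \<le> n" "0 < K" using assms b_pos by (auto simp: K_def power2_nat_le_eq_le)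
    define M where "M = n div K * b ^ b"
    have uM: "u * M = n div K * K" by (simp add: M_def K_def algebra_simps)
    have "1 \<le> n div K" using K by (simp add: Suc_le_eq div_greater_zero_iff)
    then have "K \<le> n div K * K" by simp
    then have "n mod K \<le> n div K * K" using mod_less_divisor[OF K(2), of n] by linarith
    then have "n \<le> 2 * (u * M)" using div_mult_mod_eq[of n K] uM by linarith
    then have "real n \<le> real (2 * (u * M))" by (rule of_nat_mono)
    then have "real n / 2 * (x / 2) \<le> real (u * M) * real b"
      using b_ge x1 by (intro mult_mono) auto
    then have "real n * (?l / ?ll) / 8 \<le> real (u * M * b)" by (simp add: x_def)
    moreover have "b ^ b dvd M" by (simp add: M_def)
    moreover have "u * M \<le> n" by (simp add: uM)
    ultimately show ?case using b_pos by blast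
  qed
qed

section \<open>Lower bounds\<close>

lemma axis_box_mem_directions:
  assumes "\<And>i. i \<in> {1..d} \<Longrightarrow> a i \<le> b i" "{i\<in>{1..d}. a i < b i} = D"
  shows "axis_box d a b \<in> boxes_with_directions d D"
  using assms unfolding boxes_with_directions_def by blast

lemma choice_through_two_points:
  assumes "k \<in> R" "l \<in> R" "k \<noteq> l" "x \<in> S k" "y \<in> S l" "\<And>j. j \<in> R \<Longrightarrow> S j \<noteq> {}"
  shows "\<exists>e\<in>PiE R S. e k = x \<and> e l = y"
proof
  define e where "e = restrict (\<lambda>j. if j = k then x else if j = l then y else SOME z. z \<in> S j) R"
  show "e k = x \<and> e l = y" using assms(1-3) by (simp add: e_def)
  show "e \<in> PiE R S" using assms by (auto simp: e_def some_in_eq)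
qed

text \<open>Besides giving a lower bound, this family is the witness that the maximum defining
  \<open>zarankiewicz\<close> is over a nonempty set.\<close>

lemma star_family:
  assumes "1 \<le> d" "2 \<le> r" "1 \<le> t" "direction_vector d r F" "t - 1 \<le> n"
  obtains B where "box_family d r F B" "\<forall>j\<in>{1..r}. size (B j) = n"
    "\<not> contains_complete r t B" "(t - 1) * n ^ (r - 1) \<le> card (hyperedges r B)"
proof -
  let ?R = "{1..r}"
  define unit_box where "unit_box D x = axis_box d (\<lambda>_. x) (\<lambda>i. if i \<in> D then x + 1 else x)"
    for D :: "nat set" and x :: real
  \<comment> \<open>Sides are at most 1, so a box at 5 and a box at 0 are disjoint whatever their
    direction sets; any \<open>t\<close> boxes of part 1 include one at 5.\<close>
  define f where "f j i = unit_box (F j) (if j = 1 \<and> \<not> i < t - 1 then 5 else 0)" for j i :: nat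
  have mem: "unit_box D x \<in> boxes_with_directions d D" if "D \<subseteq> {1..d}" for D x
    unfolding unit_box_def using that by (intro axis_box_mem_directions) auto
  have f_mem: "f j i \<in> boxes_with_directions d (F j)" if "j \<in> ?R" for j i
    unfolding f_def using assms(4) that by (intro mem) (auto simp: direction_vector_def)
  have disjoint: "\<exists>e\<in>PiE ?R S. (\<Inter>j\<in>?R. f j (e j)) = {}"
    if S: "\<And>j. j \<in> ?R \<Longrightarrow> S j \<subseteq> {..<n} \<and> card (S j) = t" for S
  proof -
    have nonempty: "S j \<noteq> {}" if "j \<in> ?R" for j using S[OF that] assms(3) by auto
    have "\<not> S 1 \<subseteq> {..<t - 1}"
    proof
      assume "S 1 \<subseteq> {..<t - 1}"
      then have "card (S 1) \<le> t - 1" using card_mono[of "{..<t - 1}" "S 1"] by simp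
      then show False using S[of 1] assms(2,3) by auto
    qed
    then obtain i where i: "i \<in> S 1" "\<not> i < t - 1" by auto
    obtain i' where "i' \<in> S 2" using nonempty[of 2] assms(2) by auto
    then obtain e where e: "e \<in> PiE ?R S" "e 1 = i"
      using choice_through_two_points[of 1 ?R 2 i S i'] i nonempty assms(2) by auto
    have "f 1 (e 1) \<inter> f 2 (e 2) = {}"
    proof (rule ccontr)
      assume "f 1 (e 1) \<inter> f 2 (e 2) \<noteq> {}"
      then obtain x where x: "x \<in> unit_box (F 1) 5" "x \<in> unit_box (F 2) 0"
        using e i by (auto simp: f_def)
      have "1 \<in> {1..d}" using assms(1) by simp
      then have "5 \<le> x 1" "x 1 \<le> 1"
        using PiE_mem[OF x(1)[unfolded unit_box_def axis_box_def], of 1]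
          PiE_mem[OF x(2)[unfolded unit_box_def axis_box_def], of 1]
        by (auto split: if_splits)
      then show False by simp
    qed
    moreover have "1 \<in> ?R" "2 \<in> ?R" using assms(2) by auto
    ultimately have "(\<Inter>j\<in>?R. f j (e j)) = {}" by blast
    then show ?thesis using e(1) by blast
  qed
  obtain B where B: "box_family d r F B" "\<forall>j\<in>?R. size (B j) = n"
    "\<not> contains_complete r t B"
    "card {e \<in> PiE ?R (\<lambda>_. {..<n}). (\<Inter>j\<in>?R. f j (e j)) \<noteq> {}} \<le> card (hyperedges r B)"
    by (rule indexed_box_family[of r n f d F t, OF f_mem disjoint])
  let ?A = "PiE ?R (\<lambda>j. if j = 1 then {..<t - 1} else {..<n})"
  have R: "?R = insert 1 {2..r}" using assms(2) by auto
  have "card ?A = (\<Prod>j\<in>?R. card (if j = 1 then {..<t - 1} else {..<n}))" by (simp add: card_PiE)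
  also have "\<dots> = (t - 1) * (\<Prod>j\<in>{2..r}. card (if j = 1 then {..<t - 1} else {..<n}))"
    unfolding R by (subst prod.insert) auto
  also have "(\<Prod>j\<in>{2..r}. card (if j = 1 then {..<t - 1} else {..<n})) = (\<Prod>j\<in>{2..r}. n)"
    by (rule prod.cong) auto
  finally have "card ?A = (t - 1) * n ^ (r - 1)" by simp
  moreover have "card ?A \<le> card {e \<in> PiE ?R (\<lambda>_. {..<n}). (\<Inter>j\<in>?R. f j (e j)) \<noteq> {}}"
  proof (rule card_mono)
    show "finite {e \<in> PiE ?R (\<lambda>_. {..<n}). (\<Inter>j\<in>?R. f j (e j)) \<noteq> {}}"
      by (rule finite_subset[of _ "PiE ?R (\<lambda>_. {..<n})"]) (auto intro!: finite_PiE)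
    show "?A \<subseteq> {e \<in> PiE ?R (\<lambda>_. {..<n}). (\<Inter>j\<in>?R. f j (e j)) \<noteq> {}}"
    proof
      fix e assume e: "e \<in> ?A"
      have e_n: "e j \<in> {..<n}" if "j \<in> ?R" for j
        using PiE_mem[OF e that] assms(5) by (auto split: if_splits)
      have "e 1 < t - 1" using PiE_mem[OF e, of 1] assms(2) by simp
      then have "restrict (\<lambda>_. 0) {1..d} \<in> f j (e j)" for j
        by (auto simp: f_def unit_box_def axis_box_def)
      then have "(\<Inter>j\<in>?R. f j (e j)) \<noteq> {}" by blast
      then show "e \<in> {e \<in> PiE ?R (\<lambda>_. {..<n}). (\<Inter>j\<in>?R. f j (e j)) \<noteq> {}}"
        using e e_n by (auto simp: PiE_iff)
    qed
  qed
  ultimately show ?thesis using B by (intro that[OF B(1-3)]) auto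
qed

section \<open>Families for 2-coherent direction vectors\<close>

lemma two_coherentD:
  assumes "two_coherent r F" "2 \<le> r" "direction_vector d r F"
  obtains k i i' where "k \<in> {1..r}" "i \<in> {1..d}" "i' \<in> {1..d}" "i \<noteq> i'"
    "\<forall>j\<in>{1..r} - {k}. i \<in> F j \<and> i' \<in> F j"
proof -
  obtain k where k: "k \<in> {1..r}" "2 \<le> card (\<Inter>j\<in>{1..r} - {k}. F j)"
    using assms(1) by (auto simp: two_coherent_def)
  obtain T where "T \<subseteq> (\<Inter>j\<in>{1..r} - {k}. F j)" "card T = 2"
    using obtain_subset_with_card_n[OF k(2)] by metis
  then obtain i i' where i: "i \<noteq> i'" "{i, i'} \<subseteq> (\<Inter>j\<in>{1..r} - {k}. F j)" by (metis card_2_iff)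
  \<comment> \<open>As \<open>r \<ge> 2\<close>, the intersection has a nonempty index set, so its
    elements really are directions in \<open>{1..d}\<close>.\<close>
  have "(if k = 1 then 2 else 1) \<in> {1..r} - {k}" using assms(2) by auto
  then obtain j where "j \<in> {1..r} - {k}" by blast
  then have "i \<in> {1..d}" "i' \<in> {1..d}"
    using i(2) assms(3) unfolding direction_vector_def by blast+
  then show ?thesis using that[of k i i'] k(1) i by blast
qed

text \<open>The exceptional part \<open>k\<close> supplies the points, since its boxes may be
  degenerate in the two common directions. Every other part has full extent in both, so any
  \<open>l \<noteq> k\<close> can supply the rectangles.\<close>

lemma line_family:
  assumes r: "2 \<le> r" and F: "direction_vector d r F" "two_coherent r F" and u: "0 < u"
    and b: "0 < b" and M: "b ^ b dvd M" "u * M \<le> n"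
  obtains B where "box_family d r F B" "\<forall>j\<in>{1..r}. size (B j) = n"
    "\<not> contains_complete r (Suc u) B" "n ^ (r - 2) * (u * u * M * b) \<le> card (hyperedges r B)"
proof -
  let ?R = "{1..r}"
  obtain k i1 i2 where k: "k \<in> ?R" and i: "i1 \<in> {1..d}" "i2 \<in> {1..d}" "i1 \<noteq> i2"
    and i_F: "\<forall>j\<in>?R - {k}. i1 \<in> F j \<and> i2 \<in> F j"
    by (rule two_coherentD[OF F(2) r F(1)])
  define l :: nat where "l = (if k = 1 then 2 else 1)"
  have l: "l \<in> ?R" "l \<noteq> k" using r k by (auto simp: l_def)
  \<comment> \<open>Every box contains 0 in all directions other than \<open>i1\<close> and
    \<open>i2\<close>, so whether boxes meet is decided in this plane.\<close>
  define x_y where "x_y x y i = (if i = i1 then x else if i = i2 then y else 0)" for x y :: real and i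
  define pbox where "pbox D x w y h = axis_box d (x_y x y)
    (\<lambda>i. x_y x y i + (if i \<in> D then (if i = i1 then w else if i = i2 then h else 1) else 0))"
    for D x w y h
  have pbox_mem: "pbox D x w y h \<in> boxes_with_directions d D"
    if "D \<subseteq> {1..d}" "0 < w" "0 < h" for D x w y h
    unfolding pbox_def using that by (intro axis_box_mem_directions) (auto split: if_splits)
  have pboxI: "restrict (x_y x' y') {1..d} \<in> pbox D x w y h"
    if "x \<le> x'" "x' \<le> x + (if i1 \<in> D then w else 0)" "y \<le> y'" "y' \<le> y + (if i2 \<in> D then h else 0)"
    for D x w y h x' y'
    using that i by (auto simp: pbox_def axis_box_def x_y_def split: if_splits)
  have pboxD: "x \<le> v i1" "v i1 \<le> x + w" "y \<le> v i2" "v i2 \<le> y + h"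
    if "v \<in> pbox D x w y h" "0 < w" "0 < h" for D x w y h v
    using PiE_mem[OF that(1)[unfolded pbox_def axis_box_def] i(1)]
      PiE_mem[OF that(1)[unfolded pbox_def axis_box_def] i(2)] i(3) that(2,3)
    by (auto simp: x_y_def split: if_splits)
  \<comment> \<open>The fractional side lengths keep the boxes nondegenerate without creating new incidences
    between integer points and integer rectangles.\<close>
  define f where "f j c =
    (if j = k then pbox (F j) (real (c div u)) (1/2) (real (digit_rev b b (c div u))) (1/2)
     else if j = l then pbox (F j) (real (line_x b (c div u))) (real (b ^ Suc (c div u mod b)) - 1/2)
        (real (line_y b (c div u))) (real (b ^ (b - c div u mod b)) - 1/2)
     else pbox (F j) 0 (real (Suc n)) 0 (real (b ^ b)))" for j c
  have width: "0 < real (b ^ s) - 1/2" for s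
  proof -
    have "1 \<le> b ^ s" using b by simp
    then have "1 \<le> real (b ^ s)" by (metis of_nat_1 of_nat_mono)
    then show ?thesis by simp
  qed
  have f_mem: "f j c \<in> boxes_with_directions d (F j)" if "j \<in> ?R" for j c
  proof -
    have "F j \<subseteq> {1..d}" using F(1) that by (simp add: direction_vector_def)
    then show ?thesis unfolding f_def using width b by (auto intro!: pbox_mem simp del: power_Suc)
  qed
  have on_lineD: "on_line b (c div u) (c' div u)" if "v \<in> f k c" "v \<in> f l c'" for c c' v
  proof -
    have "v \<in> pbox (F k) (real (c div u)) (1/2) (real (digit_rev b b (c div u))) (1/2)"
      using that(1) by (simp add: f_def)
    from pboxD[OF this] have 1: "real (c div u) \<le> v i1" "v i1 \<le> real (c div u) + 1/2"
      "real (digit_rev b b (c div u)) \<le> v i2" "v i2 \<le> real (digit_rev b b (c div u)) + 1/2" by auto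
    have "v \<in> pbox (F l) (real (line_x b (c' div u))) (real (b ^ Suc (c' div u mod b)) - 1/2)
        (real (line_y b (c' div u))) (real (b ^ (b - c' div u mod b)) - 1/2)"
      using that(2) l by (simp add: f_def)
    from pboxD[OF this width width] 1
    have "real (line_x b (c' div u)) < real (c div u) + 1"
      "real (c div u) < real (line_x b (c' div u) + b ^ Suc (c' div u mod b))"
      "real (line_y b (c' div u)) < real (digit_rev b b (c div u)) + 1"
      "real (digit_rev b b (c div u)) < real (line_y b (c' div u) + b ^ (b - c' div u mod b))"
      by (simp_all del: power_Suc)
    then show ?thesis unfolding on_line_iff[OF b] by linarith
  qed
  have on_lineI: "(\<Inter>j\<in>?R. f j (e j)) \<noteq> {}"
    if "on_line b (e k div u) (e l div u)" "e k < n" for e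
  proof -
    let ?q = "e k div u"
    have "restrict (x_y (real ?q) (real (digit_rev b b ?q))) {1..d} \<in> f j (e j)" if j: "j \<in> ?R" for j
    proof (cases "j = k")
      case True
      show ?thesis unfolding f_def using True by (simp only: if_True simp_thms) (rule pboxI; simp)
    next
      case False
      then have "i1 \<in> F j" "i2 \<in> F j" using i_F j by auto
      show ?thesis
      proof (cases "j = l")
        case True
        let ?g = "e l div u"
        have "line_x b ?g \<le> ?q" "Suc ?q \<le> line_x b ?g + b ^ Suc (?g mod b)"
          "line_y b ?g \<le> digit_rev b b ?q" "Suc (digit_rev b b ?q) \<le> line_y b ?g + b ^ (b - ?g mod b)"
          using on_line_iff[OF b] \<open>on_line b (e k div u) (e l div u)\<close> by (simp_all del: power_Suc)
        then have "real (line_x b ?g) \<le> real ?q"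
          "real (Suc ?q) \<le> real (line_x b ?g + b ^ Suc (?g mod b))"
          "real (line_y b ?g) \<le> real (digit_rev b b ?q)"
          "real (Suc (digit_rev b b ?q)) \<le> real (line_y b ?g + b ^ (b - ?g mod b))"
          by (simp_all only: of_nat_le_iff)
        then show ?thesis
          unfolding f_def True[symmetric] using False \<open>i1 \<in> F j\<close> \<open>i2 \<in> F j\<close>
          by (simp only: if_True if_False simp_thms) (rule pboxI; simp del: power_Suc)
      next
        case jl: False
        have "?q \<le> e k" by simp
        then have "?q \<le> n" using \<open>e k < n\<close> by linarith
        then have "real ?q \<le> real n" by simp
        moreover have "real (digit_rev b b ?q) \<le> real (b ^ b)"
          using digit_rev_less[OF b] by (simp only: of_nat_le_iff less_imp_le)
        ultimately show ?thesis
          unfolding f_def using False jl \<open>i1 \<in> F j\<close> \<open>i2 \<in> F j\<close>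
          by (simp only: if_False) (rule pboxI; simp)
      qed
    qed
    then show ?thesis by blast
  qed
  have free: "\<exists>e\<in>PiE ?R S. (\<Inter>j\<in>?R. f j (e j)) = {}"
    if S: "\<And>j. j \<in> ?R \<Longrightarrow> S j \<subseteq> {..<n} \<and> card (S j) = Suc u" for S
  proof -
    have nonempty: "S j \<noteq> {}" if "j \<in> ?R" for j using S[OF that] by auto
    \<comment> \<open>Among \<open>u + 1\<close> indices of part \<open>k\<close> there are two
      different points, and in part \<open>l\<close> two different lines. By
      \<open>on_line_unique\<close> one of the four pairs is not incident.\<close>
    obtain c c' where c: "c \<in> S k" "c' \<in> S k" "c div u \<noteq> c' div u"
      using ex_div_neq[OF u, of "S k"] S[OF k] by auto
    obtain g g' where g: "g \<in> S l" "g' \<in> S l" "g div u \<noteq> g' div u"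
      using ex_div_neq[OF u, of "S l"] S[OF l(1)] by auto
    obtain x y where xy: "x \<in> S k" "y \<in> S l" "\<not> on_line b (x div u) (y div u)"
      using on_line_unique[OF b, of "c div u" "g div u" "c' div u" "g' div u"] c g by blast
    obtain e where e: "e \<in> PiE ?R S" "e k = x" "e l = y"
      using choice_through_two_points[OF k l(1) _ xy(1,2) nonempty] l(2) by auto
    have "f k (e k) \<inter> f l (e l) = {}" using on_lineD xy(3) e by blast
    then have "(\<Inter>j\<in>?R. f j (e j)) = {}" using k l(1) by blast
    then show ?thesis using e(1) by blast
  qed
  obtain B where B: "box_family d r F B" "\<forall>j\<in>?R. size (B j) = n"
    "\<not> contains_complete r (Suc u) B"
    "card {e \<in> PiE ?R (\<lambda>_. {..<n}). (\<Inter>j\<in>?R. f j (e j)) \<noteq> {}} \<le> card (hyperedges r B)"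
    by (rule indexed_box_family[of r n f d F "Suc u", OF f_mem free])
  define P where "P = {(c, c'). c < n \<and> c' < n \<and> on_line b (c div u) (c' div u)}"
  define W where "W = PiE (?R - {k, l}) (\<lambda>_. {..<n})"
  have "card W = n ^ (r - 2)"
    using k l by (simp add: W_def card_PiE card_Diff_subset numeral_2_eq_2)
  then have "n ^ (r - 2) * (u * u * M * b) \<le> card W * card P"
    using card_on_line_ge[OF u M] by (simp add: P_def)
  also have "\<dots> = card (W \<times> P)" by (simp add: card_cartesian_product)
  also have "\<dots> \<le> card {e \<in> PiE ?R (\<lambda>_. {..<n}). (\<Inter>j\<in>?R. f j (e j)) \<noteq> {}}"
  proof (rule card_inj_on_le[where f = "\<lambda>(w, c, c'). w(k := c, l := c')"])
    show "inj_on (\<lambda>(w, c, c'). w(k := c, l := c')) (W \<times> P)"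
    proof (rule inj_onI)
      fix x y assume xy: "x \<in> W \<times> P" "y \<in> W \<times> P"
        and *: "(\<lambda>(w, c, c'). w(k := c, l := c')) x = (\<lambda>(w, c, c'). w(k := c, l := c')) y"
      obtain w c c' w' z z' where x: "x = (w, c, c')" and y: "y = (w', z, z')"
        by (metis prod_cases3)
      have w: "w \<in> W" "w' \<in> W" and eq: "w(k := c, l := c') = w'(k := z, l := z')"
        using xy * by (auto simp: x y)
      have "w j = w' j" for j
      proof (cases "j \<in> {k, l}")
        case True
        then show ?thesis using w by (auto simp: W_def PiE_def extensional_def)
      next
        case False
        then show ?thesis using fun_cong[OF eq, of j] by auto
      qed
      moreover have "c = z" "c' = z'" using fun_cong[OF eq, of k] fun_cong[OF eq, of l] l(2) by auto
      ultimately show "x = y" by (auto simp: x y)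
    qed
    show "(\<lambda>(w, c, c'). w(k := c, l := c')) ` (W \<times> P)
        \<subseteq> {e \<in> PiE ?R (\<lambda>_. {..<n}). (\<Inter>j\<in>?R. f j (e j)) \<noteq> {}}"
    proof clarify
      fix w c c' assume w: "w \<in> W" and P: "(c, c') \<in> P"
      let ?e = "w(k := c, l := c')"
      have "?e \<in> PiE ?R (\<lambda>_. {..<n})"
        using w P k l by (auto simp: W_def P_def PiE_iff extensional_def)
      moreover have "(\<Inter>j\<in>?R. f j (?e j)) \<noteq> {}"
        using P l(2) by (intro on_lineI) (auto simp: P_def)
      ultimately show "?e \<in> PiE ?R (\<lambda>_. {..<n}) \<and> (\<Inter>j\<in>?R. f j (?e j)) \<noteq> {}" by blast
    qed
    show "finite {e \<in> PiE ?R (\<lambda>_. {..<n}). (\<Inter>j\<in>?R. f j (e j)) \<noteq> {}}"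
      by (rule finite_subset[of _ "PiE ?R (\<lambda>_. {..<n})"]) (auto intro!: finite_PiE)
  qed
  also note B(4)
  finally show ?thesis using B by (intro that[OF B(1-3)])
qed

section \<open>Lower bounds for the extremal function\<close>

lemma zarankiewicz_ge_star:
  assumes "1 \<le> d" "2 \<le> r" "2 \<le> t" "direction_vector d r F" "t \<le> n"
  shows "1/2 * (real t * real n ^ (r - 1)) \<le> real (zarankiewicz d r F (\<lambda>_. n) t)"
proof -
  have "1 \<le> t" "t - 1 \<le> n" using assms(3,5) by auto
  then obtain B where B: "box_family d r F B" "\<forall>j\<in>{1..r}. size (B j) = n"
    "\<not> contains_complete r t B" "(t - 1) * n ^ (r - 1) \<le> card (hyperedges r B)"
    by (rule star_family[OF assms(1,2) _ assms(4)])
  then have "(t - 1) * n ^ (r - 1) \<le> zarankiewicz d r F (\<lambda>_. n) t"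
    using zarankiewicz_ge[of d r F B "\<lambda>_. n" t] by simp
  then have "real (t - 1) * real n ^ (r - 1) \<le> real (zarankiewicz d r F (\<lambda>_. n) t)"
    by (metis of_nat_le_iff of_nat_mult of_nat_power)
  moreover have "real t / 2 * real n ^ (r - 1) \<le> real (t - 1) * real n ^ (r - 1)"
    using assms(3) by (intro mult_right_mono) auto
  ultimately show ?thesis by simp
qed

text \<open>The constant is the \<open>1/8\<close> of \<open>eventually_ex_base\<close> times the
  \<open>1/2\<close> from \<open>t - 1 \<ge> t / 2\<close>.\<close>

lemma eventually_zarankiewicz_ge_lines:
  assumes "2 \<le> r" "2 \<le> t" "direction_vector d r F" "two_coherent r F"
  shows "\<forall>\<^sub>F n in sequentially. 1/16 * (real t * real n ^ (r - 1) * (ln (real n) / ln (ln (real n))))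
    \<le> real (zarankiewicz d r F (\<lambda>_. n) t)"
proof -
  have u: "0 < t - 1" "Suc (t - 1) = t" using assms(2) by auto
  show ?thesis using eventually_ex_base[OF u(1)]
  proof eventually_elim
    case (elim n)
    let ?x = "real n * (ln (real n) / ln (ln (real n))) / 8"
    obtain b M where b: "0 < b" "b ^ b dvd M" "(t - 1) * M \<le> n" "?x \<le> real ((t - 1) * M * b)"
      using elim by blast
    obtain B where B: "box_family d r F B" "\<forall>j\<in>{1..r}. size (B j) = n"
      "\<not> contains_complete r t B" "n ^ (r - 2) * ((t - 1) * (t - 1) * M * b) \<le> card (hyperedges r B)"
      by (rule line_family[OF assms(1,3,4) u(1) b(1,2,3), unfolded u(2)])
    have "r - 1 = Suc (r - 2)" using assms(1) by simp
    then have "real n ^ (r - 1) = real n ^ (r - 2) * real n" by simp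
    then have "1/16 * (real t * real n ^ (r - 1) * (ln (real n) / ln (ln (real n))))
        = real t / 2 * real n ^ (r - 2) * ?x" by simp
    also have "\<dots> \<le> real t / 2 * real n ^ (r - 2) * real ((t - 1) * M * b)"
      using b(4) by (intro mult_left_mono) auto
    also have "\<dots> \<le> real (t - 1) * real n ^ (r - 2) * real ((t - 1) * M * b)"
      using assms(2) by (intro mult_right_mono) auto
    also have "\<dots> = real (n ^ (r - 2) * ((t - 1) * (t - 1) * M * b))" by simp
    also have "\<dots> \<le> real (card (hyperedges r B))" using B(4) by (rule of_nat_mono)
    also have "\<dots> \<le> real (zarankiewicz d r F (\<lambda>_. n) t)"
      using zarankiewicz_ge[of d r F B "\<lambda>_. n" t] B by simp
    finally show ?case .
  qed
qed

section \<open>Upper bound\<close>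

lemma box_family_endpoints:
  assumes "box_family d r F B"
  obtains \<alpha> \<beta> where
    "\<forall>j\<in>{1..r}. \<forall>v\<in>part B j. box_of v = axis_box d (\<alpha> v) (\<beta> v)"
    "\<forall>j\<in>{1..r}. \<forall>v\<in>part B j. \<forall>i\<in>{1..d}. \<alpha> v i \<le> \<beta> v i"
    "\<forall>j\<in>{1..r}. \<forall>v\<in>part B j. \<forall>i\<in>{1..d} - F j. \<alpha> v i = \<beta> v i"
proof -
  let ?good = "\<lambda>j v a b. box_of v = axis_box d a b \<and> (\<forall>i\<in>{1..d}. a i \<le> b i) \<and>
    (\<forall>i\<in>{1..d} - F j. a i = b i)"
  have "\<exists>a b. ?good j v a b" if "j \<in> {1..r}" "v \<in> part B j" for j v
  proof -
    have "box_of v \<in># B j" using that(2) by (auto simp: part_eq_image box_of_def)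
    then have "box_of v \<in> boxes_with_directions d (F j)"
      using assms that(1) by (auto simp: box_family_def)
    then obtain a b where ab: "box_of v = axis_box d a b" "\<forall>i\<in>{1..d}. a i \<le> b i"
      "{i\<in>{1..d}. a i < b i} = F j" unfolding boxes_with_directions_def by blast
    have "a i = b i" if "i \<in> {1..d} - F j" for i using ab(2) that unfolding ab(3)[symmetric] by force
    then show ?thesis using ab by blast
  qed
  \<comment> \<open>The tag \<open>fst v\<close> recovers the part, so endpoints can be chosen as
    functions of the vertex alone.\<close>
  then have "\<forall>v. \<exists>a b. fst v \<in> {1..r} \<and> v \<in> part B (fst v) \<longrightarrow> ?good (fst v) v a b" by blast
  then obtain \<alpha> \<beta> where
    "\<forall>v. fst v \<in> {1..r} \<and> v \<in> part B (fst v) \<longrightarrow> ?good (fst v) v (\<alpha> v) (\<beta> v)"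
    unfolding choice_iff by blast
  then have good: "?good j v (\<alpha> v) (\<beta> v)" if "j \<in> {1..r}" "v \<in> part B j" for j v
    using that fst_part[OF that(2)] by blast
  show ?thesis by (rule that[of \<alpha> \<beta>]) (use good in blast)+
qed

section \<open>Reduction of box families to box systems\<close>

locale complete_free_box_family =
  fixes d r t :: nat and F :: "nat \<Rightarrow> nat set" and B :: "nat \<Rightarrow> (nat \<Rightarrow> real) set multiset"
    and \<alpha> \<beta> :: "box_vertex \<Rightarrow> nat \<Rightarrow> real"
  assumes r_ge: "2 \<le> r" and t_pos: "0 < t"
    and box_of_eq: "\<forall>j\<in>{1..r}. \<forall>v\<in>part B j. box_of v = axis_box d (\<alpha> v) (\<beta> v)"
    and le: "\<forall>j\<in>{1..r}. \<forall>v\<in>part B j. \<forall>i\<in>{1..d}. \<alpha> v i \<le> \<beta> v i"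
    and degenerate: "\<forall>j\<in>{1..r}. \<forall>v\<in>part B j. \<forall>i\<in>{1..d} - F j. \<alpha> v i = \<beta> v i"
    and free: "\<not> contains_complete r t B"
begin

lemma crossing_iff:
  assumes "e \<in> PiE {1..r} (part B)"
  shows "e \<in> crossing r B \<longleftrightarrow> (\<exists>x. \<forall>j\<in>{1..r}. \<forall>i\<in>{1..d}. \<alpha> (e j) i \<le> x i \<and> x i \<le> \<beta> (e j) i)"
proof -
  have box: "box_of (e j) = axis_box d (\<alpha> (e j)) (\<beta> (e j))" if "j \<in> {1..r}" for j
    using box_of_eq that PiE_mem[OF assms that] by blast
  show ?thesis
  proof
    assume "e \<in> crossing r B"
    then obtain x where x: "\<forall>j\<in>{1..r}. x \<in> box_of (e j)" by (auto simp: crossing_def)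
    have "\<alpha> (e j) i \<le> x i \<and> x i \<le> \<beta> (e j) i" if "j \<in> {1..r}" "i \<in> {1..d}" for j i
    proof -
      have "x \<in> PiE {1..d} (\<lambda>i. {\<alpha> (e j) i..\<beta> (e j) i})"
        using x box[OF that(1)] that(1) by (auto simp: axis_box_def)
      from PiE_mem[OF this that(2)] show ?thesis by simp
    qed
    then show "\<exists>x. \<forall>j\<in>{1..r}. \<forall>i\<in>{1..d}. \<alpha> (e j) i \<le> x i \<and> x i \<le> \<beta> (e j) i" by blast
  next
    assume "\<exists>x. \<forall>j\<in>{1..r}. \<forall>i\<in>{1..d}. \<alpha> (e j) i \<le> x i \<and> x i \<le> \<beta> (e j) i"
    then obtain x where x: "\<forall>j\<in>{1..r}. \<forall>i\<in>{1..d}. \<alpha> (e j) i \<le> x i \<and> x i \<le> \<beta> (e j) i" by blast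
    then have "restrict x {1..d} \<in> box_of (e j)" if "j \<in> {1..r}" for j
      unfolding box[OF that] axis_box_def using that by auto
    then have "(\<Inter>j\<in>{1..r}. box_of (e j)) \<noteq> {}" by blast
    then show "e \<in> crossing r B" using assms by (simp add: crossing_def)
  qed
qed

text \<open>
  In a pinned direction two parts are degenerate, so any \<open>r - 1\<close> boxes of a hyperedge determine
  that coordinate of a common point. Hence the sum over the values of the pinned coordinates of the
  bounds for the individual slices is no larger than the bound for the whole family.
\<close>

definition pinned :: "nat \<Rightarrow> bool"
  where "pinned i \<longleftrightarrow> (\<exists>j\<in>{1..r}. \<exists>j'\<in>{1..r}. j \<noteq> j' \<and> i \<notin> F j \<and> i \<notin> F j')"

text \<open>
  Requiring \<open>e k\<close> to have the largest left endpoint in direction \<open>c k\<close> allows us to treat it as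
  degenerate there, located at its left endpoint.
\<close>

lemma card_leftmost_crossing:
  assumes K: "K \<subseteq> {1..r}" and c: "\<And>k. k \<in> K \<Longrightarrow> c k \<in> {1..d}"
    and cover: "\<And>i. i \<in> {1..d} \<Longrightarrow> \<not> pinned i \<Longrightarrow> i \<in> c ` K"
  shows "card {e \<in> crossing r B. \<forall>k\<in>K. \<forall>j\<in>{1..r}. \<alpha> (e j) (c k) \<le> \<alpha> (e k) (c k)}
    \<le> (18 * r + 3) * t * (\<Sum>k\<in>{1..r}. \<Prod>m\<in>{1..r}-{k}. size (B m))"
proof -
  let ?R = "{1..r}"
  define H where "H = {e \<in> crossing r B. \<forall>k\<in>K. \<forall>j\<in>?R. \<alpha> (e j) (c k) \<le> \<alpha> (e k) (c k)}"
  define P where "P = {i\<in>{1..d}. pinned i}"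
  have "finite (\<Union>m\<in>?R. part B m)" by (intro finite_UN_I finite_part) simp
  then obtain idx :: "box_vertex \<Rightarrow> nat" and N where
    idx: "idx ` (\<Union>m\<in>?R. part B m) = {i. i < N}" "inj_on idx (\<Union>m\<in>?R. part B m)"
    by (elim finite_imp_inj_to_nat_seg[THEN exE]) blast
  have idx_le: "idx v \<le> N" if "v \<in> part B m" "m \<in> ?R" for v m
  proof -
    have "idx v \<in> idx ` (\<Union>m\<in>?R. part B m)" using that by blast
    then show ?thesis unfolding idx(1) by simp
  qed
  define V where "V s m = {v \<in> part B m. \<forall>i\<in>P. \<alpha> v i \<le> s i \<and> s i \<le> \<beta> v i}" for s m
  \<comment> \<open>The model has one direction per part. For a part outside \<open>K\<close>, which
    owns no direction, all coordinates are 0 and the test in its direction is void.\<close>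
  define coord where "coord \<gamma> k v = (if k \<in> K then \<gamma> v (c k) else 0)"
    for \<gamma> :: "box_vertex \<Rightarrow> nat \<Rightarrow> real" and k v
  \<comment> \<open>The index breaks ties lexicographically.\<close>
  define p where "p k v = (coord \<alpha> k v, idx v)" for k v
  \<comment> \<open>The extreme second components 0 and \<open>N\<close> make comparisons with
    \<open>p\<close> depend on the coordinates only, so breaking ties creates and destroys no
    edges.\<close>
  define L where "L j k v = (coord \<alpha> k v, 0 :: nat)" for j :: nat and k v
  define U where "U j k v = (coord \<beta> k v, N)" for j :: nat and k v
  have V_part: "V s m \<subseteq> part B m" for s m by (auto simp: V_def)
  have sys: "box_system ?R (V s) p" for s
  proof
    show "finite (V s j)" for j using V_part finite_part finite_subset by metis
    have "inj_on idx (V s j)" if "j \<in> ?R" for j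
      by (rule inj_on_subset[OF idx(2)]) (use V_part that in blast)
    then show "inj_on (p j) (V s j)" if "j \<in> ?R" for j
      using that by (auto simp: inj_on_def p_def)
  qed simp
  define E where "E s = box_system.edges ?R (V s) p L U" for s
  have E_iff: "e \<in> E s \<longleftrightarrow> e \<in> PiE ?R (V s) \<and>
      (\<forall>j\<in>?R. \<forall>k\<in>?R. j \<noteq> k \<longrightarrow> L j k (e j) \<le> p k (e k) \<and> p k (e k) \<le> U j k (e j))" for e s
    unfolding E_def box_system.edges_def[OF sys] box_system.spans_def[OF sys] by simp
  have E_crossing: "E s \<subseteq> crossing r B" for s
  proof
    fix e assume e: "e \<in> E s"
    then have eV: "e j \<in> V s j" if "j \<in> ?R" for j using that by (auto simp: E_iff)
    then have eP: "e j \<in> part B j" if "j \<in> ?R" for j using that V_part by blast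
    have "\<exists>y. \<forall>j\<in>?R. \<alpha> (e j) i \<le> y \<and> y \<le> \<beta> (e j) i" if i: "i \<in> {1..d}" for i
    proof (cases "pinned i")
      case True
      then show ?thesis using eV i by (intro exI[of _ "s i"]) (auto simp: V_def P_def)
    next
      case False
      then obtain k where k: "k \<in> K" "i = c k" using cover i by blast
      have kR: "k \<in> ?R" using k(1) K by blast
      have "\<alpha> (e j) i \<le> \<alpha> (e k) i \<and> \<alpha> (e k) i \<le> \<beta> (e j) i" if j: "j \<in> ?R" for j
      proof (cases "j = k")
        case True
        then show ?thesis using le eP j i by blast
      next
        case False
        then have "L j k (e j) \<le> p k (e k)" "p k (e k) \<le> U j k (e j)"
          using e j kR unfolding E_iff by blast+
        then show ?thesis using k by (auto simp: L_def U_def p_def coord_def less_eq_prod_def)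
      qed
      then show ?thesis by blast
    qed
    then have "\<forall>i. \<exists>y. i \<in> {1..d} \<longrightarrow> (\<forall>j\<in>?R. \<alpha> (e j) i \<le> y \<and> y \<le> \<beta> (e j) i)" by blast
    then obtain x where "\<forall>i. i \<in> {1..d} \<longrightarrow> (\<forall>j\<in>?R. \<alpha> (e j) i \<le> x i \<and> x i \<le> \<beta> (e j) i)"
      unfolding choice_iff by blast
    then have "\<exists>x. \<forall>j\<in>?R. \<forall>i\<in>{1..d}. \<alpha> (e j) i \<le> x i \<and> x i \<le> \<beta> (e j) i" by blast
    moreover have "e \<in> PiE ?R (part B)" using e eP by (auto simp: E_iff PiE_iff)
    ultimately show "e \<in> crossing r B" using crossing_iff by blast
  qed
  have card_E: "card (E s) \<le> (18 * r + 3) * t * (\<Sum>k\<in>?R. \<Prod>m\<in>?R-{k}. card (V s m))" for s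
  proof -
    interpret complete_free_box_system ?R "V s" p L U t 1
    proof (intro complete_free_box_system.intro complete_free_box_system_axioms.intro sys)
      show "1 \<in> ?R" using r_ge by simp
      show "\<not> PiE ?R S \<subseteq> box_system.edges ?R (V s) p L U"
        if S: "\<And>j. j \<in> ?R \<Longrightarrow> S j \<subseteq> V s j \<and> card (S j) = t" for S
      proof
        assume "PiE ?R S \<subseteq> box_system.edges ?R (V s) p L U"
        then have "PiE ?R S \<subseteq> crossing r B" using E_crossing[of s] by (simp add: E_def)
        moreover have "\<forall>j\<in>?R. S j \<subseteq> part B j \<and> card (S j) = t" using S V_part by blast
        ultimately show False using free unfolding contains_complete_iff by blast
      qed
    qed (rule t_pos)
    show ?thesis using card_edges_le by (simp add: E_def)
  qed
  \<comment> \<open>Conversely, every hyperedge in \<open>H\<close> is an edge of the slice given by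
    one of its common points. Restricting that point to \<open>P\<close> makes the label depend on
    pinned coordinates only, which is what makes different slices disjoint below.\<close>
  have "\<exists>x. e \<in> E x \<and> x \<in> extensional P" if "e \<in> H" for e
  proof -
    have e: "e \<in> crossing r B" and left: "\<forall>k\<in>K. \<forall>j\<in>?R. \<alpha> (e j) (c k) \<le> \<alpha> (e k) (c k)"
      using that by (auto simp: H_def)
    have ePE: "e \<in> PiE ?R (part B)" using e crossing_subset by blast
    then have eP: "e j \<in> part B j" if "j \<in> ?R" for j using that by auto
    obtain x where x: "\<forall>j\<in>?R. \<forall>i\<in>{1..d}. \<alpha> (e j) i \<le> x i \<and> x i \<le> \<beta> (e j) i"
      using e crossing_iff[OF ePE] by blast
    have "e \<in> PiE ?R (V (restrict x P))"
      using ePE x by (auto simp: PiE_iff V_def P_def)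
    moreover have "L j k (e j) \<le> p k (e k) \<and> p k (e k) \<le> U j k (e j)" if jk: "j \<in> ?R" "k \<in> ?R" for j k
    proof (cases "k \<in> K")
      case True
      have "\<alpha> (e j) (c k) \<le> \<alpha> (e k) (c k)" using left True jk by blast
      moreover have "\<alpha> (e k) (c k) \<le> x (c k)" "x (c k) \<le> \<beta> (e j) (c k)" using x c[OF True] jk by blast+
      ultimately show ?thesis
        using True idx_le[OF eP[OF jk(2)] jk(2)] by (auto simp: L_def U_def p_def coord_def less_eq_prod_def)
    next
      case False
      then show ?thesis
        using idx_le[OF eP[OF jk(2)] jk(2)] by (auto simp: L_def U_def p_def coord_def less_eq_prod_def)
    qed
    ultimately have "e \<in> E (restrict x P)" by (simp add: E_iff)
    then show ?thesis by (meson restrict_extensional)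
  qed
  then have "\<forall>e. \<exists>x. e \<in> H \<longrightarrow> e \<in> E x \<and> x \<in> extensional P" by blast
  then obtain label where "\<forall>e. e \<in> H \<longrightarrow> e \<in> E (label e) \<and> label e \<in> extensional P"
    unfolding choice_iff by blast
  then have label: "e \<in> E (label e)" "label e \<in> extensional P" if "e \<in> H" for e using that by auto
  define S where "S = label ` H"
  have fin_H: "finite H" using finite_crossing by (simp add: H_def)
  then have fin_S: "finite S" by (simp add: S_def)
  have fin_E: "finite (E s)" for s using finite_subset[OF E_crossing finite_crossing] .
  have "card H \<le> card (\<Union>s\<in>S. E s)"
  proof (rule card_mono)
    show "finite (\<Union>s\<in>S. E s)" by (intro finite_UN_I fin_S fin_E)
    show "H \<subseteq> (\<Union>s\<in>S. E s)" using label(1) by (auto simp: S_def)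
  qed
  also have "\<dots> \<le> (\<Sum>s\<in>S. card (E s))" by (rule card_UN_le[OF fin_S])
  also have "\<dots> \<le> (\<Sum>s\<in>S. (18 * r + 3) * t * (\<Sum>k\<in>?R. \<Prod>m\<in>?R-{k}. card (V s m)))"
    by (intro sum_mono card_E)
  also have "\<dots> = (18 * r + 3) * t * (\<Sum>k\<in>?R. \<Sum>s\<in>S. \<Prod>m\<in>?R-{k}. card (V s m))"
    by (subst sum.swap) (simp add: sum_distrib_left)
  also have "\<dots> \<le> (18 * r + 3) * t * (\<Sum>k\<in>?R. \<Prod>m\<in>?R-{k}. size (B m))"
  proof (intro mult_left_mono sum_mono)
    fix k assume k: "k \<in> ?R"
    let ?W = "\<lambda>s. PiE (?R-{k}) (V s)"
    have fin_V: "finite (V s m)" for s m using V_part finite_part finite_subset by metis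
    have disj: "s = s'" if s: "s \<in> S" "s' \<in> S" and w: "w \<in> ?W s" "w \<in> ?W s'" for s s' w
    proof (rule extensionalityI[of _ P])
      show "s \<in> extensional P" "s' \<in> extensional P" using s label by (auto simp: S_def)
      fix i assume i: "i \<in> P"
      then obtain m where m: "m \<in> ?R" "m \<noteq> k" "i \<notin> F m" unfolding P_def pinned_def by blast
      have "w m \<in> V s m" "w m \<in> V s' m" using PiE_mem[OF w(1), of m] PiE_mem[OF w(2), of m] m by simp_all
      then have "\<alpha> (w m) i \<le> s i" "s i \<le> \<beta> (w m) i" "\<alpha> (w m) i \<le> s' i" "s' i \<le> \<beta> (w m) i"
        and wm: "w m \<in> part B m" using i by (simp_all add: V_def)
      moreover have "i \<in> {1..d} - F m" using i m(3) by (simp add: P_def)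
      then have "\<alpha> (w m) i = \<beta> (w m) i" using degenerate m(1) wm by blast
      ultimately show "s i = s' i" by simp
    qed
    have "(\<Sum>s\<in>S. \<Prod>m\<in>?R-{k}. card (V s m)) = (\<Sum>s\<in>S. card (?W s))" by (simp add: card_PiE)
    also have "\<dots> = card (\<Union>s\<in>S. ?W s)"
    proof (rule card_UN_disjoint[symmetric, OF fin_S])
      show "\<forall>s\<in>S. finite (?W s)" using fin_V by (auto intro!: finite_PiE)
      show "\<forall>s\<in>S. \<forall>s'\<in>S. s \<noteq> s' \<longrightarrow> ?W s \<inter> ?W s' = {}" using disj by blast
    qed
    also have "\<dots> \<le> card (PiE (?R-{k}) (part B))"
    proof (rule card_mono)
      show "finite (PiE (?R-{k}) (part B))" by (intro finite_PiE finite_part) auto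
      show "(\<Union>s\<in>S. ?W s) \<subseteq> PiE (?R-{k}) (part B)" by (intro UN_least PiE_mono V_part)
    qed
    finally show "(\<Sum>s\<in>S. \<Prod>m\<in>?R-{k}. card (V s m)) \<le> (\<Prod>m\<in>?R-{k}. size (B m))"
      by (simp add: card_PiE card_part)
  qed simp
  finally show ?thesis by (simp add: H_def)
qed

text \<open>If some direction is nondegenerate in all parts, hyperedges are classified by the part
  with the largest left endpoint in it, which costs the factor \<open>r\<close>. Otherwise every
  unpinned direction is owned by the part that is degenerate in it; a degenerate box of a hyperedge
  automatically has the largest left endpoint, so one class suffices.\<close>

lemma card_crossing_le:
  assumes F: "direction_vector d r F" "\<not> two_coherent r F"
  shows "card (crossing r B) \<le> r * ((18 * r + 3) * t * (\<Sum>k\<in>{1..r}. \<Prod>m\<in>{1..r}-{k}. size (B m)))"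
proof -
  let ?R = "{1..r}"
  define N where "N = (18 * r + 3) * t * (\<Sum>k\<in>?R. \<Prod>m\<in>?R-{k}. size (B m))"
  define leftmost where
    "leftmost K c = {e \<in> crossing r B. \<forall>k\<in>K. \<forall>j\<in>?R. \<alpha> (e j) (c k) \<le> \<alpha> (e k) (c k)}" for K c
  have leftmost: "card (leftmost K c) \<le> N"
    if "K \<subseteq> ?R" "\<And>k. k \<in> K \<Longrightarrow> c k \<in> {1..d}"
      "\<And>i. i \<in> {1..d} \<Longrightarrow> \<not> pinned i \<Longrightarrow> i \<in> c ` K" for K c
    unfolding leftmost_def N_def using that by (rule card_leftmost_crossing)
  have unique: "i = i'" if k: "k \<in> ?R" and i: "\<forall>j\<in>?R-{k}. i \<in> F j" "\<forall>j\<in>?R-{k}. i' \<in> F j" for k i i'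
  proof (rule ccontr)
    assume "i \<noteq> i'"
    have "(if k = 1 then 2 else 1) \<in> ?R - {k}" using r_ge by auto
    then obtain j where "j \<in> ?R - {k}" by blast
    moreover from this have "F j \<subseteq> {1..d}" using F(1) by (simp add: direction_vector_def)
    ultimately have "(\<Inter>j\<in>?R-{k}. F j) \<subseteq> {1..d}" by blast
    then have "finite (\<Inter>j\<in>?R-{k}. F j)" by (rule finite_subset) simp
    moreover have "{i, i'} \<subseteq> (\<Inter>j\<in>?R-{k}. F j)" using i by blast
    ultimately have "card {i, i'} \<le> card (\<Inter>j\<in>?R-{k}. F j)" by (rule card_mono)
    moreover have "\<not> 2 \<le> card (\<Inter>j\<in>?R-{k}. F j)" using F(2) k unfolding two_coherent_def by blast
    ultimately show False using \<open>i \<noteq> i'\<close> by simp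
  qed
  have miss: "\<forall>j\<in>?R-{k}. i \<in> F j" if "\<not> pinned i" "i \<notin> F k" "k \<in> ?R" for i k
    using that unfolding pinned_def by blast
  have fin: "finite (leftmost K c)" for K c using finite_crossing by (simp add: leftmost_def)
  show ?thesis
  proof (cases "\<exists>i0\<in>{1..d}. \<forall>j\<in>?R. i0 \<in> F j")
    case True
    then obtain i0 where i0: "i0 \<in> {1..d}" "\<forall>j\<in>?R. i0 \<in> F j" by blast
    have "crossing r B \<subseteq> (\<Union>k\<in>?R. leftmost {k} (\<lambda>_. i0))"
    proof
      fix e assume e: "e \<in> crossing r B"
      have "Max ((\<lambda>j. \<alpha> (e j) i0) ` ?R) \<in> (\<lambda>j. \<alpha> (e j) i0) ` ?R" using r_ge by (intro Max_in) auto
      then obtain k where k: "k \<in> ?R" "\<alpha> (e k) i0 = Max ((\<lambda>j. \<alpha> (e j) i0) ` ?R)" by auto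
      then have "\<forall>j\<in>?R. \<alpha> (e j) i0 \<le> \<alpha> (e k) i0" by simp
      then show "e \<in> (\<Union>k\<in>?R. leftmost {k} (\<lambda>_. i0))" using e k(1) by (auto simp: leftmost_def)
    qed
    then have "card (crossing r B) \<le> card (\<Union>k\<in>?R. leftmost {k} (\<lambda>_. i0))"
      using fin by (intro card_mono) auto
    also have "\<dots> \<le> (\<Sum>k\<in>?R. card (leftmost {k} (\<lambda>_. i0)))" by (rule card_UN_le) simp
    also have "\<dots> \<le> (\<Sum>k\<in>?R. N)"
    proof (rule sum_mono)
      fix k assume k: "k \<in> ?R"
      show "card (leftmost {k} (\<lambda>_. i0)) \<le> N"
      proof (rule leftmost)
        fix i assume i: "i \<in> {1..d}" "\<not> pinned i"
        have "\<exists>k'\<in>?R. \<forall>j\<in>?R-{k'}. i \<in> F j"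
        proof (cases "\<exists>k'\<in>?R. i \<notin> F k'")
          case True
          then show ?thesis using miss[OF i(2)] by blast
        next
          case False
          then show ?thesis using k by blast
        qed
        then obtain k' where k': "k' \<in> ?R" "\<forall>j\<in>?R-{k'}. i \<in> F j" by blast
        moreover have "\<forall>j\<in>?R-{k'}. i0 \<in> F j" using i0(2) by blast
        ultimately have "i = i0" by (rule unique)
        then show "i \<in> (\<lambda>_. i0) ` {k}" by simp
      qed (use k i0 in auto)
    qed
    finally show ?thesis by (simp add: N_def)
  next
    case False
    define K where "K = {k\<in>?R. \<exists>i\<in>{1..d}. \<not> pinned i \<and> i \<notin> F k}"
    have "\<forall>k\<in>K. \<exists>i. i \<in> {1..d} \<and> \<not> pinned i \<and> i \<notin> F k" by (auto simp: K_def)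
    then obtain c where c: "\<And>k. k \<in> K \<Longrightarrow> c k \<in> {1..d} \<and> \<not> pinned (c k) \<and> c k \<notin> F k" by metis
    have K: "K \<subseteq> ?R" by (auto simp: K_def)
    have "crossing r B \<subseteq> leftmost K c"
    proof
      fix e assume e: "e \<in> crossing r B"
      then have ePE: "e \<in> PiE ?R (part B)" using crossing_subset by blast
      obtain x where x: "\<forall>j\<in>?R. \<forall>i\<in>{1..d}. \<alpha> (e j) i \<le> x i \<and> x i \<le> \<beta> (e j) i"
        using e crossing_iff[OF ePE] by blast
      have "\<alpha> (e j) (c k) \<le> \<alpha> (e k) (c k)" if "k \<in> K" "j \<in> ?R" for j k
      proof -
        have k: "k \<in> ?R" using that K by blast
        have ck: "c k \<in> {1..d}" using c[OF that(1)] by blast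
        have "\<alpha> (e j) (c k) \<le> x (c k)" "x (c k) \<le> \<beta> (e k) (c k)" using x ck that(2) k by blast+
        moreover have "\<alpha> (e k) (c k) = \<beta> (e k) (c k)"
          using degenerate k PiE_mem[OF ePE k] ck c[OF that(1)] by simp
        ultimately show ?thesis by simp
      qed
      then show "e \<in> leftmost K c" using e by (simp add: leftmost_def)
    qed
    then have "card (crossing r B) \<le> card (leftmost K c)" using fin by (intro card_mono)
    also have "\<dots> \<le> N"
    proof (rule leftmost[OF K])
      show "c k \<in> {1..d}" if "k \<in> K" for k using c[OF that] by blast
      fix i assume i: "i \<in> {1..d}" "\<not> pinned i"
      then obtain k where k: "k \<in> ?R" "i \<notin> F k" using False by blast
      then have "k \<in> K" using i by (auto simp: K_def)
      have "c k = i"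
        by (rule unique[OF k(1) miss miss]) (use i k c[OF \<open>k \<in> K\<close>] in auto)
      then show "i \<in> c ` K" using \<open>k \<in> K\<close> by blast
    qed
    also have "N \<le> r * N" using r_ge by simp
    finally show ?thesis by (simp add: N_def)
  qed
qed

end

section \<open>Bounds for the extremal function\<close>

lemma zarankiewicz_upper:
  assumes "1 \<le> d" "2 \<le> r" "1 \<le> t" "direction_vector d r F" "\<not> two_coherent r F" "t \<le> n"
  shows "zarankiewicz d r F (\<lambda>_. n) t \<le> r * ((18 * r + 3) * t * (r * n ^ (r - 1)))"
proof -
  have "t - 1 \<le> n" using assms(6) by simp
  then obtain B0 where B0: "box_family d r F B0" "\<forall>j\<in>{1..r}. size (B0 j) = n" "\<not> contains_complete r t B0"
    by (rule star_family[OF assms(1-4)])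
  show ?thesis
  proof (rule zarankiewicz_le[OF B0(1) _ B0(3)])
    show "size (B0 j) = n" if "j \<in> {1..r}" for j using B0(2) that by blast
    fix B assume B: "box_family d r F B" "\<And>j. j \<in> {1..r} \<Longrightarrow> size (B j) = n" "\<not> contains_complete r t B"
    obtain \<alpha> \<beta> where
      "\<forall>j\<in>{1..r}. \<forall>v\<in>part B j. box_of v = axis_box d (\<alpha> v) (\<beta> v)"
      "\<forall>j\<in>{1..r}. \<forall>v\<in>part B j. \<forall>i\<in>{1..d}. \<alpha> v i \<le> \<beta> v i"
      "\<forall>j\<in>{1..r}. \<forall>v\<in>part B j. \<forall>i\<in>{1..d} - F j. \<alpha> v i = \<beta> v i"
      by (rule box_family_endpoints[OF B(1)])
    then interpret complete_free_box_family d r t F B \<alpha> \<beta>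
      using assms(2,3) B(3) by unfold_locales auto
    have "(\<Prod>m\<in>{1..r}-{k}. size (B m)) = n ^ (r - 1)" if "k \<in> {1..r}" for k
      using that B(2) by (simp add: card_Diff_singleton)
    then have "(\<Sum>k\<in>{1..r}. \<Prod>m\<in>{1..r}-{k}. size (B m)) = r * n ^ (r - 1)" by simp
    then show "card (hyperedges r B) \<le> r * ((18 * r + 3) * t * (r * n ^ (r - 1)))"
      using card_crossing_le[OF assms(4,5)] by (simp only: card_hyperedges)
  qed
qed

text \<open>The order of quantifiers carries the content of the asymptotic notation: constants are
  chosen before \<open>d\<close>, \<open>t\<close> and \<open>F\<close>, while the threshold for
  \<open>n\<close> may depend on them. In the 2-coherent case the constant is absolute.\<close>

theorem theorem1p1:
  "(\<forall>r\<ge>2. \<exists>c C :: real. c > 0 \<and> C > 0 \<and>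
      (\<forall>d\<ge>1. \<forall>t\<ge>2. \<forall>F. direction_vector d r F \<and> \<not> two_coherent r F \<longrightarrow>
        (\<forall>\<^sub>F n in sequentially.
          c * (real t * real n ^ (r - 1)) \<le> real (zarankiewicz d r F (\<lambda>_. n) t) \<and>
          real (zarankiewicz d r F (\<lambda>_. n) t) \<le> C * (real t * real n ^ (r - 1))))) \<and>
   (\<exists>c :: real. c > 0 \<and>
      (\<forall>r\<ge>2. \<forall>d\<ge>1. \<forall>t\<ge>2. \<forall>F. direction_vector d r F \<and> two_coherent r F \<longrightarrow>
        (\<forall>\<^sub>F n in sequentially.
          c * (real t * real n ^ (r - 1) * (ln (real n) / ln (ln (real n))))
            \<le> real (zarankiewicz d r F (\<lambda>_. n) t))))"
proof (intro conjI allI impI)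
  fix r :: nat assume r: "2 \<le> r"
  define C where "C = real (r * ((18 * r + 3) * r))"
  \<comment> \<open>Here the threshold is explicit: both bounds hold as soon as
    \<open>t \<le> n\<close>.\<close>
  have "1/2 * (real t * real n ^ (r - 1)) \<le> real (zarankiewicz d r F (\<lambda>_. n) t) \<and>
      real (zarankiewicz d r F (\<lambda>_. n) t) \<le> C * (real t * real n ^ (r - 1))"
    if "1 \<le> d" "2 \<le> t" "direction_vector d r F" "\<not> two_coherent r F" "t \<le> n" for d t F n
  proof
    show "1/2 * (real t * real n ^ (r - 1)) \<le> real (zarankiewicz d r F (\<lambda>_. n) t)"
      using zarankiewicz_ge_star r that by blast
    have "zarankiewicz d r F (\<lambda>_. n) t \<le> r * ((18 * r + 3) * t * (r * n ^ (r - 1)))"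
      using that r by (intro zarankiewicz_upper) auto
    then have "real (zarankiewicz d r F (\<lambda>_. n) t) \<le> real (r * ((18 * r + 3) * t * (r * n ^ (r - 1))))"
      by (rule of_nat_mono)
    then show "real (zarankiewicz d r F (\<lambda>_. n) t) \<le> C * (real t * real n ^ (r - 1))"
      by (simp add: C_def algebra_simps)
  qed
  then have "\<forall>d\<ge>1. \<forall>t\<ge>2. \<forall>F. direction_vector d r F \<and> \<not> two_coherent r F \<longrightarrow>
      (\<forall>\<^sub>F n in sequentially.
        1/2 * (real t * real n ^ (r - 1)) \<le> real (zarankiewicz d r F (\<lambda>_. n) t) \<and>
        real (zarankiewicz d r F (\<lambda>_. n) t) \<le> C * (real t * real n ^ (r - 1)))"
    unfolding eventually_sequentially by blast
  moreover have "C > 0" using r by (simp add: C_def)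
  ultimately show "\<exists>c C :: real. c > 0 \<and> C > 0 \<and>
      (\<forall>d\<ge>1. \<forall>t\<ge>2. \<forall>F. direction_vector d r F \<and> \<not> two_coherent r F \<longrightarrow>
        (\<forall>\<^sub>F n in sequentially.
          c * (real t * real n ^ (r - 1)) \<le> real (zarankiewicz d r F (\<lambda>_. n) t) \<and>
          real (zarankiewicz d r F (\<lambda>_. n) t) \<le> C * (real t * real n ^ (r - 1))))"
    by (intro exI[of _ "1/2"] exI[of _ C] conjI) simp_all
next
  show "\<exists>c :: real. c > 0 \<and>
      (\<forall>r\<ge>2. \<forall>d\<ge>1. \<forall>t\<ge>2. \<forall>F. direction_vector d r F \<and> two_coherent r F \<longrightarrow>
        (\<forall>\<^sub>F n in sequentially.
          c * (real t * real n ^ (r - 1) * (ln (real n) / ln (ln (real n))))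
            \<le> real (zarankiewicz d r F (\<lambda>_. n) t)))"
    by (intro exI[of _ "1/16"] conjI allI impI eventually_zarankiewicz_ge_lines) auto
qed

end
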